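(* Let $n,m\in\mathbb{N}_0$. If $\operatorname{Ext}^1_{\mathcal{D}}(L(n),L(m))\neq0$, then $m-n\in\{2,0,-2\}$.
   Context: $\Bbbk$ is an algebraically closed field of characteristic $0$; $\mathbb{N}_0=\{0,1,2,\dots\}$. $\mathcal{D}$ (the double of the Jordan plane) is the $\Bbbk$-algebra presented by generators $u, v, \xi, g, g^{-1}, x, y$ and relations $g g^{-1}=g^{-1}g=1$, $\xi g=g\xi$, $gx=xg$, $gy=yg+xg$, $\xi y=y\xi-2y$, $\xi x=x\xi-2x$, $ug=gu$, $vg=gv+gu$, $v\xi=\xi v-2v$, $u\xi=\xi u-2u$, $yx=xy-\tfrac12x^2$, $vu=uv-\tfrac12u^2$, $ux=xu$, $vx=xv+(1-g)+xu$, $uy=yu+(1-g)$, $vy=yv+\tfrac12 g\xi+yu$. Modules are left modules. For $n\in\mathbb{N}_0$, $L(n)$ is the simple $\mathcal{D}$-module with basis $z_{n,0},\dots,z_{n,n}$ and action $\xi\cdot z_{n,i}=(n-2i)z_{n,i}$, $v\cdot z_{n,i}=\tfrac{i(n-i+1)}2z_{n,i-1}$, $y\cdot z_{n,i}=z_{n,i+1}$, $x\cdot z_{n,i}=0$, $u\cdot z_{n,i}=0$, $g\cdot z_{n,i}=z_{n,i}$, where $z_{n,-1}=z_{n,n+1}=0$. An extension of $L(n)$ by $L(m)$ is a short exact sequence $0\to L(n)\to T\to L(m)\to0$ of $\mathcal{D}$-modules; $\operatorname{Ext}^1_{\mathcal{D}}(L(n),L(m))$ denotes the vector space of equivalence classes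 of such extensions. *)

theory Defs
  imports
    "HOL-Algebra.QuotRing"
    "HOL-Algebra.Algebraic_Closure_Type"
    "HOL-Algebra.Module"
    "HOL-Library.Poly_Mapping"
    "HOL-Computational_Algebra.Polynomial"
begin

section \<open>Left modules over a ring that need not be commutative\<close>

text \<open>The axioms are those of the library locale \<^locale>\<open>module\<close>, which requires a
  commutative ring of scalars.  The fields \<^const>\<open>monoid.mult\<close> and \<^const>\<open>one\<close> that the record type
  \<^typ>\<open>('d, 'a) module\<close> inherits from rings play no role.\<close>

locale left_module = R?: ring R + M?: abelian_group M
  for R :: "('d, 'r) ring_scheme" (structure) and M :: "('d, 'a) module" (structure) +
  assumes smult_closed:
      "\<lbrakk>a \<in> carrier R; x \<in> carrier M\<rbrakk> \<Longrightarrow> a \<odot>\<^bsub>M\<^esub> x \<in> carrier M"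
    and smult_l_distr:
      "\<lbrakk>a \<in> carrier R; b \<in> carrier R; x \<in> carrier M\<rbrakk> \<Longrightarrow>
        (a \<oplus>\<^bsub>R\<^esub> b) \<odot>\<^bsub>M\<^esub> x = a \<odot>\<^bsub>M\<^esub> x \<oplus>\<^bsub>M\<^esub> b \<odot>\<^bsub>M\<^esub> x"
    and smult_r_distr:
      "\<lbrakk>a \<in> carrier R; x \<in> carrier M; y \<in> carrier M\<rbrakk> \<Longrightarrow>
        a \<odot>\<^bsub>M\<^esub> (x \<oplus>\<^bsub>M\<^esub> y) = a \<odot>\<^bsub>M\<^esub> x \<oplus>\<^bsub>M\<^esub> a \<odot>\<^bsub>M\<^esub> y"
    and smult_assoc:
      "\<lbrakk>a \<in> carrier R; b \<in> carrier R; x \<in> carrier M\<rbrakk> \<Longrightarrow>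
        (a \<otimes>\<^bsub>R\<^esub> b) \<odot>\<^bsub>M\<^esub> x = a \<odot>\<^bsub>M\<^esub> (b \<odot>\<^bsub>M\<^esub> x)"
    and smult_one:
      "x \<in> carrier M \<Longrightarrow> \<one>\<^bsub>R\<^esub> \<odot>\<^bsub>M\<^esub> x = x"

definition lmod_hom ::
  "('d, 'r) ring_scheme \<Rightarrow> ('d, 'a) module \<Rightarrow> ('d, 'b) module \<Rightarrow> ('a \<Rightarrow> 'b) set" where
  "lmod_hom R M N =
    {h. h \<in> carrier M \<rightarrow> carrier N \<and>
        (\<forall>x\<in>carrier M. \<forall>y\<in>carrier M. h (x \<oplus>\<^bsub>M\<^esub> y) = h x \<oplus>\<^bsub>N\<^esub> h y) \<and>
        (\<forall>a\<in>carrier R. \<forall>x\<in>carrier M. h (a \<odot>\<^bsub>M\<^esub> x) = a \<odot>\<^bsub>N\<^esub> h x)}"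

definition lmod_sum :: "('d, 'a) module \<Rightarrow> ('d, 'b) module \<Rightarrow> ('d, 'a \<times> 'b) module" where
  "lmod_sum M N =
    \<lparr>carrier = carrier M \<times> carrier N, monoid.mult = undefined, one = undefined,
     zero = (\<zero>\<^bsub>M\<^esub>, \<zero>\<^bsub>N\<^esub>),
     add = (\<lambda>(x, y) (x', y'). (x \<oplus>\<^bsub>M\<^esub> x', y \<oplus>\<^bsub>N\<^esub> y')),
     module.smult = (\<lambda>a (x, y). (a \<odot>\<^bsub>M\<^esub> x, a \<odot>\<^bsub>N\<^esub> y))\<rparr>"


section \<open>Extensions and their equivalence classes\<close>

text \<open>A triple \<open>(T, i, p)\<close> stands for the sequence \<open>0 \<rightarrow> A \<rightarrow> T \<rightarrow> B \<rightarrow> 0\<close> with maps \<open>i\<close> and \<open>p\<close>.\<close>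

type_synonym ('d, 'a, 't, 'b) ses = "('d, 't) module \<times> ('a \<Rightarrow> 't) \<times> ('t \<Rightarrow> 'b)"

definition is_extension ::
  "('d, 'r) ring_scheme \<Rightarrow> ('d, 'a) module \<Rightarrow> ('d, 'b) module \<Rightarrow> ('d, 'a, 't, 'b) ses \<Rightarrow> bool" where
  "is_extension R A B E \<longleftrightarrow> (case E of (T, i, p) \<Rightarrow>
     left_module R T \<and> i \<in> lmod_hom R A T \<and> p \<in> lmod_hom R T B \<and>
     inj_on i (carrier A) \<and> i ` carrier A = a_kernel T B p \<and> p ` carrier T = carrier B)"

definition ext_equivalent ::
  "('d, 'r) ring_scheme \<Rightarrow> ('d, 'a) module \<Rightarrow> ('d, 'a, 't, 'b) ses \<Rightarrow> ('d, 'a, 's, 'b) ses \<Rightarrow> bool" where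
  "ext_equivalent R A E E' \<longleftrightarrow> (case E of (T, i, p) \<Rightarrow> case E' of (T', i', p') \<Rightarrow>
     \<exists>\<phi> \<in> lmod_hom R T T'. bij_betw \<phi> (carrier T) (carrier T') \<and>
       (\<forall>a\<in>carrier A. \<phi> (i a) = i' a) \<and> (\<forall>t\<in>carrier T. p' (\<phi> t) = p t))"

text \<open>Equivalence classes of extensions \<open>0 \<rightarrow> A \<rightarrow> T \<rightarrow> B \<rightarrow> 0\<close>: the first argument is the
  submodule and the second the quotient, which is the reverse of the more common convention for
  \<open>Ext\<^sup>1(A, B)\<close>.  The elements of the middle terms are taken from the type \<^typ>\<open>'a \<times> 'b\<close>; as shown
  in \<open>ext_equivalent_product\<close> below, this loses no extension up to equivalence.  The zero vector of
  the space of classes (for the Baer sum) is the class of the split extension.\<close>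

definition ext_rel ::
  "('d, 'r) ring_scheme \<Rightarrow> ('d, 'a) module \<Rightarrow> ('d, 'b) module \<Rightarrow> ('d, 'a, 'a \<times> 'b, 'b) ses rel" where
  "ext_rel R A B =
    {(E, E'). is_extension R A B E \<and> is_extension R A B E' \<and> ext_equivalent R A E E'}"

definition Ext1 ::
  "('d, 'r) ring_scheme \<Rightarrow> ('d, 'a) module \<Rightarrow> ('d, 'b) module \<Rightarrow> ('d, 'a, 'a \<times> 'b, 'b) ses set set" where
  "Ext1 R A B = {E. is_extension R A B E} // ext_rel R A B"

definition split_extension ::
  "('d, 'a) module \<Rightarrow> ('d, 'b) module \<Rightarrow> ('d, 'a, 'a \<times> 'b, 'b) ses" where
  "split_extension A B = (lmod_sum A B, \<lambda>a. (a, \<zero>\<^bsub>B\<^esub>), snd)"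

definition Ext1_zero ::
  "('d, 'r) ring_scheme \<Rightarrow> ('d, 'a) module \<Rightarrow> ('d, 'b) module \<Rightarrow> ('d, 'a, 'a \<times> 'b, 'b) ses set" where
  "Ext1_zero R A B = ext_rel R A B `` {split_extension A B}"


section \<open>The double of the Jordan plane\<close>

datatype gen = GU | GV | GXi | GG | GGinv | GX | GY

instantiation list :: (type) monoid_add
begin
definition zero_list :: "'a list" where "zero_list = []"
definition plus_list :: "'a list \<Rightarrow> 'a list \<Rightarrow> 'a list" where "plus_list = (@)"
instance by standard (simp_all add: zero_list_def plus_list_def)
end

text \<open>With concatenation as addition on words, the convolution product on finitely supported
  functions is that of the free associative algebra on the generators.\<close>

type_synonym 'k free_alg = "gen list \<Rightarrow>\<^sub>0 'k"

abbreviation free_ring :: "('k::field) free_alg ring" where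
  "free_ring \<equiv> ring_of_type_algebra"

abbreviation scal :: "'k::field \<Rightarrow> 'k free_alg" where
  "scal c \<equiv> Poly_Mapping.single [] c"

abbreviation gvar :: "gen \<Rightarrow> ('k::field) free_alg" where
  "gvar a \<equiv> Poly_Mapping.single [a] 1"

definition D_relators :: "('k::field) free_alg set" where
  "D_relators =
    (let u = gvar GU; v = gvar GV; \<xi> = gvar GXi; g = gvar GG; g' = gvar GGinv; x = gvar GX; y = gvar GY;
         half = scal (1/2)
     in (\<lambda>(l, r). l - r) `
      {(g * g', 1), (g' * g, 1),
       (\<xi> * g, g * \<xi>),
       (g * x, x * g),
       (g * y, y * g + x * g),
       (\<xi> * y, y * \<xi> - 2 * y),
       (\<xi> * x, x * \<xi> - 2 * x),
       (u * g, g * u),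
       (v * g, g * v + g * u),
       (v * \<xi>, \<xi> * v - 2 * v),
       (u * \<xi>, \<xi> * u - 2 * u),
       (y * x, x * y - half * (x * x)),
       (v * u, u * v - half * (u * u)),
       (u * x, x * u),
       (v * x, x * v + (1 - g) + x * u),
       (u * y, y * u + (1 - g)),
       (v * y, y * v + half * (g * \<xi>) + y * u)})"

definition D_ideal :: "('k::field) free_alg set" where
  "D_ideal = genideal free_ring D_relators"

definition D_ring :: "('k::field) free_alg set ring" where
  "D_ring = free_ring Quot D_ideal"


section \<open>The simple modules \<open>L(n)\<close>\<close>

text \<open>The vector space with basis \<open>z\<^sub>n\<^sub>,\<^sub>0, \<dots>, z\<^sub>n\<^sub>,\<^sub>n\<close> is the space of coordinate functions
  vanishing beyond \<open>n\<close>.  For \<open>i = 0\<close> the truncated index \<open>i - 1\<close> in the action of \<open>v\<close> is harmless,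
  as the coefficient vanishes.\<close>

definition zvec :: "nat \<Rightarrow> nat \<Rightarrow> nat \<Rightarrow> 'k::field" where
  "zvec n i = (\<lambda>j. if i \<le> n \<and> j = i then 1 else 0)"

fun gen_basis :: "nat \<Rightarrow> gen \<Rightarrow> nat \<Rightarrow> nat \<Rightarrow> 'k::field" where
  "gen_basis n GXi i = (\<lambda>j. (of_nat n - 2 * of_nat i) * zvec n i j)"
| "gen_basis n GV i = (\<lambda>j. of_nat i * (of_nat n - of_nat i + 1) / 2 * zvec n (i - 1) j)"
| "gen_basis n GY i = zvec n (i + 1)"
| "gen_basis n GX i = (\<lambda>j. 0)"
| "gen_basis n GU i = (\<lambda>j. 0)"
| "gen_basis n GG i = zvec n i"
| "gen_basis n GGinv i = zvec n i"

definition gen_act :: "nat \<Rightarrow> gen \<Rightarrow> (nat \<Rightarrow> 'k::field) \<Rightarrow> nat \<Rightarrow> 'k" where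
  "gen_act n a f = (\<lambda>j. \<Sum>i\<le>n. f i * gen_basis n a i j)"

definition free_act :: "nat \<Rightarrow> ('k::field) free_alg \<Rightarrow> (nat \<Rightarrow> 'k) \<Rightarrow> nat \<Rightarrow> 'k" where
  "free_act n p f =
    (\<lambda>j. \<Sum>w\<in>Poly_Mapping.keys p. Poly_Mapping.lookup p w * foldr (gen_act n) w f j)"

text \<open>An element of \<^const>\<open>D_ring\<close> is a coset \<open>C\<close>, whose representatives all act in the same way;
  see \<open>L_smult_coset\<close> below.\<close>

definition L :: "nat \<Rightarrow> (('k::field) free_alg set, nat \<Rightarrow> 'k) module" where
  "L n =
    \<lparr>carrier = {f. \<forall>j>n. f j = 0}, monoid.mult = undefined, one = undefined,
     zero = (\<lambda>_. 0), add = (\<lambda>f h j. f j + h j),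
     module.smult = (\<lambda>C f. the_elem ((\<lambda>p. free_act n p f) ` C))\<rparr>"


subsection \<open>The action is well defined\<close>

lemma poly_mapping_sum_single:
  "p = (\<Sum>w\<in>Poly_Mapping.keys p. Poly_Mapping.single w (Poly_Mapping.lookup p w))"
  by (rule poly_mapping_eqI)
    (auto simp: lookup_sum lookup_single when_def in_keys_iff sum.delta)

lemma gen_act_add: "gen_act n a (\<lambda>j. f j + h j) = (\<lambda>j. gen_act n a f j + gen_act n a h j)"
  by (simp add: gen_act_def fun_eq_iff algebra_simps sum.distrib)

lemma gen_act_scale: "gen_act n a (\<lambda>j. c * f j) = (\<lambda>j. c * gen_act n a f j)"
  by (simp add: gen_act_def fun_eq_iff sum_distrib_left mult.assoc)

lemma word_act_add:
  "foldr (gen_act n) w (\<lambda>j. f j + h j) =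
    (\<lambda>j. foldr (gen_act n) w f j + foldr (gen_act n) w h j)"
  by (induction w) (simp_all add: gen_act_add)

lemma word_act_scale:
  "foldr (gen_act n) w (\<lambda>j. c * f j) = (\<lambda>j. c * foldr (gen_act n) w f j)"
  by (induction w) (simp_all add: gen_act_scale)

lemma free_act_superset:
  assumes "finite S" "Poly_Mapping.keys p \<subseteq> S"
  shows "free_act n p f j = (\<Sum>w\<in>S. Poly_Mapping.lookup p w * foldr (gen_act n) w f j)"
  unfolding free_act_def
  by (rule sum.mono_neutral_left) (use assms in \<open>auto simp: in_keys_iff\<close>)

lemma free_act_zero [simp]: "free_act n 0 f = (\<lambda>j. 0)"
  by (simp add: free_act_def)

lemma free_act_single:
  "free_act n (Poly_Mapping.single w c) f = (\<lambda>j. c * foldr (gen_act n) w f j)"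
  by (simp add: free_act_def fun_eq_iff)

lemma free_act_plus: "free_act n (p + q) f = (\<lambda>j. free_act n p f j + free_act n q f j)"
proof
  fix j
  let ?S = "Poly_Mapping.keys p \<union> Poly_Mapping.keys q"
  have "free_act n r f j = (\<Sum>w\<in>?S. Poly_Mapping.lookup r w * foldr (gen_act n) w f j)"
    if "Poly_Mapping.keys r \<subseteq> ?S" for r
    using that by (intro free_act_superset) auto
  then show "free_act n (p + q) f j = free_act n p f j + free_act n q f j"
    using keys_add[of p q] by (simp add: lookup_add algebra_simps sum.distrib)
qed

lemma free_act_minus: "free_act n (p - q) f = (\<lambda>j. free_act n p f j - free_act n q f j)"
  using free_act_plus[of n "p - q" q f] by (simp add: fun_eq_iff)

lemma free_act_sum: "free_act n (sum P S) f = (\<lambda>j. \<Sum>s\<in>S. free_act n (P s) f j)"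
  by (induction S rule: infinite_finite_induct) (simp_all add: free_act_plus)

lemma free_act_add: "free_act n p (\<lambda>j. f j + h j) = (\<lambda>j. free_act n p f j + free_act n p h j)"
  by (simp add: free_act_def word_act_add fun_eq_iff algebra_simps sum.distrib)

lemma free_act_scale: "free_act n p (\<lambda>j. c * f j) = (\<lambda>j. c * free_act n p f j)"
  by (simp add: free_act_def word_act_scale fun_eq_iff sum_distrib_left mult.left_commute)

lemma free_act_at_zero [simp]: "free_act n p (\<lambda>j. 0) = (\<lambda>j. 0)"
  using free_act_scale[of n p 0 "\<lambda>j. 0"] by simp

lemma free_act_sum_arg: "free_act n p (\<lambda>j. \<Sum>s\<in>S. F s j) = (\<lambda>j. \<Sum>s\<in>S. free_act n p (F s) j)"
  by (induction S rule: infinite_finite_induct) (simp_all add: free_act_add)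

lemma free_act_one [simp]: "free_act n 1 f = f"
  using free_act_single[of n "0 :: gen list" 1 f, unfolded single_one] by (simp add: zero_list_def)

lemma free_act_single_mult:
  "free_act n (Poly_Mapping.single w c * Poly_Mapping.single w' d) f =
    free_act n (Poly_Mapping.single w c) (free_act n (Poly_Mapping.single w' d) f)"
  by (simp add: mult_single free_act_single plus_list_def word_act_scale mult.assoc)

lemma free_act_mult: "free_act n (p * q) f = free_act n p (free_act n q f)"
proof -
  let ?s = "\<lambda>r w. Poly_Mapping.single w (Poly_Mapping.lookup r w)"
  have "p * q = (\<Sum>w\<in>Poly_Mapping.keys p. \<Sum>w'\<in>Poly_Mapping.keys q. ?s p w * ?s q w')"
    by (subst poly_mapping_sum_single[of p], subst poly_mapping_sum_single[of q])
      (simp add: sum_product)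
  then have "free_act n (p * q) f =
      (\<lambda>j. \<Sum>w\<in>Poly_Mapping.keys p. \<Sum>w'\<in>Poly_Mapping.keys q.
        free_act n (?s p w) (free_act n (?s q w') f) j)"
    by (simp add: free_act_sum free_act_single_mult)
  also have "\<dots> = (\<lambda>j. \<Sum>w\<in>Poly_Mapping.keys p. free_act n (?s p w) (free_act n q f) j)"
    by (subst (2) poly_mapping_sum_single[of q])
      (simp only: free_act_sum free_act_sum_arg)
  also have "\<dots> = free_act n p (free_act n q f)"
    by (subst (2) poly_mapping_sum_single[of p]) (simp only: free_act_sum)
  finally show ?thesis .
qed

lemma gen_act_simps:
  assumes "\<forall>j>n. f j = 0"
  shows "gen_act n GXi f = (\<lambda>j. (of_nat n - 2 * of_nat j) * f j)"
    and "gen_act n GV f = (\<lambda>j. of_nat (j + 1) * (of_nat n - of_nat j) / 2 * f (j + 1))"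
    and "gen_act n GY f = (\<lambda>j. if 1 \<le> j \<and> j \<le> n then f (j - 1) else 0)"
    and "gen_act n GX f = (\<lambda>j. 0)"
    and "gen_act n GU f = (\<lambda>j. 0)"
    and "gen_act n GG f = f"
    and "gen_act n GGinv f = f"
proof -
  have id: "(\<Sum>i\<le>n. f i * (c i * zvec n i j)) = c j * f j" for c j
  proof -
    have "(\<Sum>i\<le>n. f i * (c i * zvec n i j)) = (\<Sum>i\<le>n. if i = j then c i * f i else 0)"
      by (intro sum.cong) (auto simp: zvec_def)
    also have "\<dots> = c j * f j"
      using assms by (simp add: sum.delta)
    finally show ?thesis .
  qed
  show "gen_act n GXi f = (\<lambda>j. (of_nat n - 2 * of_nat j) * f j)"
    by (simp add: gen_act_def fun_eq_iff id)
  show "gen_act n GG f = f" "gen_act n GGinv f = f"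
    using id[of "\<lambda>_. 1"] by (simp_all add: gen_act_def fun_eq_iff)
  show "gen_act n GX f = (\<lambda>j. 0)" "gen_act n GU f = (\<lambda>j. 0)"
    by (simp_all add: gen_act_def)
  show "gen_act n GV f = (\<lambda>j. of_nat (j + 1) * (of_nat n - of_nat j) / 2 * f (j + 1))"
  proof
    fix j
    have "gen_act n GV f j =
        (\<Sum>i\<le>n. if i = j + 1 then of_nat (j + 1) * (of_nat n - of_nat j) / 2 * f (j + 1) else 0)"
      unfolding gen_act_def
    proof (intro sum.cong refl)
      fix i assume "i \<in> {..n}"
      then show "f i * gen_basis n GV i j =
          (if i = j + 1 then of_nat (j + 1) * (of_nat n - of_nat j) / 2 * f (j + 1) else 0)"
        by (cases i) (auto simp: zvec_def)
    qed
    also have "\<dots> = of_nat (j + 1) * (of_nat n - of_nat j) / 2 * f (j + 1)"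
      using assms by (simp add: sum.delta)
    finally show "gen_act n GV f j = of_nat (j + 1) * (of_nat n - of_nat j) / 2 * f (j + 1)" .
  qed
  show "gen_act n GY f = (\<lambda>j. if 1 \<le> j \<and> j \<le> n then f (j - 1) else 0)"
  proof
    fix j
    have "gen_act n GY f j = (\<Sum>i\<le>n. if i = j - 1 then (if 1 \<le> j \<and> j \<le> n then f i else 0) else 0)"
      unfolding gen_act_def by (intro sum.cong) (auto simp: zvec_def)
    also have "\<dots> = (if 1 \<le> j \<and> j \<le> n then f (j - 1) else 0)"
      by (simp add: sum.delta) linarith
    finally show "gen_act n GY f j = (if 1 \<le> j \<and> j \<le> n then f (j - 1) else 0)" .
  qed
qed

lemma gen_act_closed: "\<forall>j>n. gen_act n a f j = 0"
  by (cases a) (auto simp: gen_act_def zvec_def intro!: sum.neutral)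

lemma free_act_closed:
  assumes "\<forall>j>n. f j = 0"
  shows "\<forall>j>n. free_act n p f j = 0"
proof -
  have "\<forall>j>n. foldr (gen_act n) w f j = 0" for w
    by (cases w) (simp_all add: assms gen_act_closed)
  then show ?thesis
    by (simp add: free_act_def)
qed

lemma free_act_relators:
  fixes f :: "nat \<Rightarrow> 'k::field_char_0"
  assumes f: "\<forall>j>n. f j = 0" and r: "r \<in> D_relators"
  shows "free_act n r f = (\<lambda>j. 0)"
proof -
  have var: "free_act n (gvar a) h = gen_act n a h" for a and h :: "nat \<Rightarrow> 'k"
    by (simp add: free_act_single)
  have scal: "free_act n (scal c) h = (\<lambda>j. c * h j)" for c and h :: "nat \<Rightarrow> 'k"
    by (simp add: free_act_single)
  have two: "2 * p = p + p" for p :: "'k free_alg"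
    by (simp add: mult_2)
  have c: "\<forall>j>n. gen_act n a h j = 0" for a and h :: "nat \<Rightarrow> 'k"
    by (rule gen_act_closed)
  have zero: "gen_act n a (\<lambda>j. 0) = (\<lambda>j. 0 :: 'k)" for a
    by (simp add: gen_act_def)
  have dec: "of_nat (x - Suc 0) = (of_nat x - 1 :: 'k)" if "1 \<le> x" for x
    using that by (simp add: of_nat_diff)
  show ?thesis
    using r unfolding D_relators_def Let_def image_insert image_empty insert_iff empty_iff prod.case
    apply (elim disjE)
    apply (simp_all only: two free_act_minus free_act_plus free_act_mult var scal free_act_one)
    apply (simp_all only: gen_act_simps[OF c])
    apply (simp_all only: gen_act_simps[OF f] zero)
    using f
    apply (auto simp: fun_eq_iff not_le field_simps dec)
    subgoal for x by (cases "x = n") auto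
    done
qed


lemma ring_free_ring: "ring (free_ring :: ('k::field) free_alg ring)"
proof (rule ringI)
  show "abelian_group (free_ring :: 'k free_alg ring)"
    by (rule abelian_groupI)
      (auto simp: ring_of_type_algebra_def add.assoc add.commute intro: exI[of _ "- x" for x])
  show "Group.monoid (free_ring :: 'k free_alg ring)"
    by (rule monoidI) (auto simp: ring_of_type_algebra_def mult.assoc)
qed (auto simp: ring_of_type_algebra_def distrib_left distrib_right)

lemma free_ring_simps:
  "carrier free_ring = UNIV" "\<one>\<^bsub>free_ring\<^esub> = 1" "\<zero>\<^bsub>free_ring\<^esub> = 0"
  "p \<oplus>\<^bsub>free_ring\<^esub> q = p + q" "p \<otimes>\<^bsub>free_ring\<^esub> q = p * q"
  by (simp_all add: ring_of_type_algebra_def)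

lemma ideal_D_ideal: "ideal D_ideal (free_ring :: ('k::field) free_alg ring)"
  unfolding D_ideal_def
  by (rule ring.genideal_ideal[OF ring_free_ring]) (simp add: free_ring_simps)

lemma ring_D_ring: "ring (D_ring :: ('k::field) free_alg set ring)"
  unfolding D_ring_def by (rule ideal.quotient_is_ring[OF ideal_D_ideal])

lemma free_act_D_ideal:
  fixes f :: "nat \<Rightarrow> 'k::field_char_0"
  assumes "p \<in> D_ideal" "\<forall>j>n. f j = 0"
  shows "free_act n p f = (\<lambda>j. 0)"
proof -
  define K where "K = {p :: 'k free_alg. \<forall>f. (\<forall>j>n. f j = 0) \<longrightarrow> free_act n p f = (\<lambda>j. 0)}"
  have neg: "free_act n (- q) h = (\<lambda>j. - free_act n q h j)" for q :: "'k free_alg" and h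
    using free_act_minus[of n 0 q h] by simp
  interpret F: ring "free_ring :: 'k free_alg ring" by (rule ring_free_ring)
  have inv: "inv\<^bsub>add_monoid free_ring\<^esub> q = - q" for q :: "'k free_alg"
    using F.minus_equality[of "- q" q] by (simp add: free_ring_simps a_inv_def)
  have "ideal K free_ring"
  proof (rule idealI)
    show "subgroup K (add_monoid (free_ring :: 'k free_alg ring))"
    proof (rule group.subgroupI[OF F.a_group])
      have "0 \<in> K"
        by (simp add: K_def)
      then show "K \<noteq> {}"
        by blast
    qed (simp_all only: inv, simp_all add: K_def free_ring_simps free_act_plus neg)
  qed (auto simp: K_def free_ring_simps free_act_mult free_act_closed intro!: ring_free_ring)
  moreover have "D_relators \<subseteq> K"
    by (auto simp: K_def free_act_relators)
  ultimately have "D_ideal \<subseteq> K"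
    unfolding D_ideal_def by (rule ring.genideal_minimal[OF ring_free_ring])
  with assms show ?thesis
    by (auto simp: K_def)
qed

lemma L_smult_coset:
  fixes f :: "nat \<Rightarrow> 'k::field_char_0"
  assumes "f \<in> carrier (L n)"
  shows "(D_ideal +>\<^bsub>free_ring\<^esub> p) \<odot>\<^bsub>L n\<^esub> f = free_act n p f"
proof -
  interpret ideal D_ideal "free_ring :: 'k free_alg ring" by (rule ideal_D_ideal)
  have f: "\<forall>j>n. f j = 0"
    using assms by (simp add: L_def)
  have "(\<lambda>q. free_act n q f) ` (D_ideal +>\<^bsub>free_ring\<^esub> p) = {free_act n p f}"
  proof -
    have "free_act n q f = free_act n p f" if q: "q \<in> D_ideal +>\<^bsub>free_ring\<^esub> p" for q
    proof -
      from q obtain d where "d \<in> D_ideal" "q = d + p"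
        by (auto simp: a_r_coset_def r_coset_def free_ring_simps)
      with f show ?thesis
        by (simp add: free_act_plus free_act_D_ideal)
    qed
    moreover have "p \<in> D_ideal +>\<^bsub>free_ring\<^esub> p"
      by (rule a_rcos_self) (simp add: free_ring_simps)
    ultimately show ?thesis
      by blast
  qed
  then show ?thesis
    by (simp add: L_def)
qed

lemma zvec_in_carrier: "zvec n i \<in> carrier (L n)"
  by (auto simp: L_def zvec_def)

lemma L_generator_action:
  assumes "i \<le> n"
  shows "(D_ideal +>\<^bsub>free_ring\<^esub> gvar a) \<odot>\<^bsub>L n\<^esub> zvec n i = (gen_basis n a i :: nat \<Rightarrow> 'k::field_char_0)"
proof -
  have "gen_act n a (zvec n i) = (gen_basis n a i :: nat \<Rightarrow> 'k)"
  proof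
    fix j
    have "gen_act n a (zvec n i) j = (\<Sum>l\<le>n. if l = i then gen_basis n a i j else (0 :: 'k))"
      unfolding gen_act_def using assms by (intro sum.cong) (auto simp: zvec_def)
    then show "gen_act n a (zvec n i) j = (gen_basis n a i j :: 'k)"
      using assms by simp
  qed
  then show ?thesis
    by (simp add: L_smult_coset zvec_in_carrier free_act_single)
qed

lemma left_module_L: "left_module D_ring (L n :: (('k::field_char_0) free_alg set, nat \<Rightarrow> 'k) module)"
proof -
  let ?L = "L n :: ('k free_alg set, nat \<Rightarrow> 'k) module"
  let ?c = "\<lambda>p :: 'k free_alg. D_ideal +>\<^bsub>free_ring\<^esub> p"
  interpret ideal D_ideal "free_ring :: 'k free_alg ring" by (rule ideal_D_ideal)
  interpret q: ring_hom_ring free_ring D_ring ?c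
    unfolding D_ring_def by (rule rcos_ring_hom_ring)
  have coset: "\<exists>p. a = ?c p" if "a \<in> carrier D_ring" for a
    using that by (auto simp: D_ring_def FactRing_def A_RCOSETS_def' free_ring_simps)
  have hom: "?c p \<oplus>\<^bsub>D_ring\<^esub> ?c q = ?c (p + q)" "?c p \<otimes>\<^bsub>D_ring\<^esub> ?c q = ?c (p * q)" 
    "\<one>\<^bsub>D_ring\<^esub> = ?c 1" for p q
    using q.hom_add[of p q] q.hom_mult[of p q] q.hom_one by (simp_all add: free_ring_simps)
  have cl: "free_act n p f \<in> carrier ?L" if "f \<in> carrier ?L" for p f
    using that free_act_closed[of n f p] by (simp add: L_def)
  have addL: "f \<oplus>\<^bsub>?L\<^esub> h = (\<lambda>j. f j + h j)" for f h
    by (simp add: L_def)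
  have add_cl: "(\<lambda>j. f j + h j) \<in> carrier ?L" if "f \<in> carrier ?L" "h \<in> carrier ?L" for f h
    using that by (simp add: L_def)
  have "abelian_group ?L"
  proof (rule abelian_groupI)
    fix f assume "f \<in> carrier ?L"
    then show "\<exists>h\<in>carrier ?L. h \<oplus>\<^bsub>?L\<^esub> f = \<zero>\<^bsub>?L\<^esub>"
      by (intro bexI[of _ "\<lambda>j. - f j"]) (auto simp: L_def)
  qed (auto simp: L_def)
  moreover have "left_module_axioms D_ring ?L"
    by unfold_locales
      (auto dest!: coset simp: hom L_smult_coset cl addL add_cl free_act_plus free_act_add
        free_act_mult)
  ultimately show ?thesis
    by (intro left_module.intro ring_D_ring)
qed


subsection \<open>Equivalence of extensions\<close>

lemma ext_equivalent_refl: "ext_equivalent R A E E"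
  unfolding ext_equivalent_def
  by (cases E) (auto simp: lmod_hom_def bij_betw_def inj_on_def intro!: exI[of _ "\<lambda>t. t"])

lemma ext_equivalent_sym:
  assumes E: "is_extension R A B E" and EE': "ext_equivalent R A E E'"
  shows "ext_equivalent R A E' E"
proof -
  obtain T i p where [simp]: "E = (T, i, p)" by (cases E)
  obtain T' i' p' where [simp]: "E' = (T', i', p')" by (cases E')
  from E have i: "i \<in> carrier A \<rightarrow> carrier T" and T: "left_module R T"
    by (auto simp: is_extension_def lmod_hom_def)
  interpret T: left_module R T by (rule T)
  from EE' obtain \<phi> where h: "\<phi> \<in> lmod_hom R T T'" and b: "bij_betw \<phi> (carrier T) (carrier T')"
    and c: "\<forall>a\<in>carrier A. \<phi> (i a) = i' a" "\<forall>t\<in>carrier T. p' (\<phi> t) = p t"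
    by (auto simp: ext_equivalent_def)
  define \<psi> where "\<psi> = inv_into (carrier T) \<phi>"
  have \<psi>: "bij_betw \<psi> (carrier T') (carrier T)"
    unfolding \<psi>_def using b by (rule bij_betw_inv_into)
  have \<phi>\<psi>: "\<phi> (\<psi> t') = t'" "\<psi> t' \<in> carrier T" if "t' \<in> carrier T'" for t'
    using that b \<psi> by (auto simp: \<psi>_def bij_betw_inv_into_right bij_betwE)
  have \<psi>\<phi>: "\<psi> (\<phi> t) = t" if "t \<in> carrier T" for t
    using that b by (simp add: \<psi>_def bij_betw_inv_into_left)
  have "\<psi> \<in> lmod_hom R T' T"
    unfolding lmod_hom_def
  proof (intro CollectI conjI ballI)
    show "\<psi> \<in> carrier T' \<rightarrow> carrier T"
      using \<phi>\<psi> by auto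
    show "\<psi> (x \<oplus>\<^bsub>T'\<^esub> y) = \<psi> x \<oplus>\<^bsub>T\<^esub> \<psi> y" if "x \<in> carrier T'" "y \<in> carrier T'" for x y
    proof -
      have "x \<oplus>\<^bsub>T'\<^esub> y = \<phi> (\<psi> x \<oplus>\<^bsub>T\<^esub> \<psi> y)"
        using h \<phi>\<psi> that by (simp add: lmod_hom_def)
      then show ?thesis
        using \<psi>\<phi> \<phi>\<psi> that by simp
    qed
    show "\<psi> (a \<odot>\<^bsub>T'\<^esub> x) = a \<odot>\<^bsub>T\<^esub> \<psi> x" if "a \<in> carrier R" "x \<in> carrier T'" for a x
    proof -
      have "a \<odot>\<^bsub>T'\<^esub> x = \<phi> (a \<odot>\<^bsub>T\<^esub> \<psi> x)"
        using h \<phi>\<psi> that by (simp add: lmod_hom_def)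
      then show ?thesis
        using \<psi>\<phi> \<phi>\<psi> that T.smult_closed by simp
    qed
  qed
  moreover have "\<psi> (i' a) = i a" if "a \<in> carrier A" for a
    using c(1) that i \<psi>\<phi> by (metis funcset_mem)
  moreover have "p (\<psi> t') = p' t'" if "t' \<in> carrier T'" for t'
    using c(2) that \<phi>\<psi> by metis
  ultimately show ?thesis
    using \<psi> by (auto simp: ext_equivalent_def)
qed

lemma ext_equivalent_trans:
  assumes "ext_equivalent R A E E'" "ext_equivalent R A E' E''"
  shows "ext_equivalent R A E E''"
proof -
  obtain T i p where [simp]: "E = (T, i, p)" by (cases E)
  obtain T' i' p' where [simp]: "E' = (T', i', p')" by (cases E')
  obtain T'' i'' p'' where [simp]: "E'' = (T'', i'', p'')" by (cases E'')
  from assms(1) obtain \<phi> where \<phi>: "\<phi> \<in> lmod_hom R T T'" "bij_betw \<phi> (carrier T) (carrier T')"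
    "\<forall>a\<in>carrier A. \<phi> (i a) = i' a" "\<forall>t\<in>carrier T. p' (\<phi> t) = p t"
    by (auto simp: ext_equivalent_def)
  from assms(2) obtain \<psi> where \<psi>: "\<psi> \<in> lmod_hom R T' T''" "bij_betw \<psi> (carrier T') (carrier T'')"
    "\<forall>a\<in>carrier A. \<psi> (i' a) = i'' a" "\<forall>t\<in>carrier T'. p'' (\<psi> t) = p' t"
    by (auto simp: ext_equivalent_def)
  have "\<psi> \<circ> \<phi> \<in> lmod_hom R T T''"
    using \<phi>(1) \<psi>(1) by (auto simp: lmod_hom_def Pi_iff)
  moreover have "bij_betw (\<psi> \<circ> \<phi>) (carrier T) (carrier T'')"
    using \<phi>(2) \<psi>(2) by (rule bij_betw_trans)
  ultimately show ?thesis
    using \<phi> \<psi>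
    by (auto simp: ext_equivalent_def lmod_hom_def Pi_iff intro!: exI[of _ "\<psi> \<circ> \<phi>"])
qed

lemma equiv_ext_rel: "equiv {E. is_extension R A B E} (ext_rel R A B)"
  by (intro equivI refl_onI symI transI)
    (auto simp: ext_rel_def intro: ext_equivalent_refl ext_equivalent_sym ext_equivalent_trans)

lemma is_extension_split:
  assumes "left_module R A" "left_module R B"
  shows "is_extension R A B (split_extension A B)"
proof -
  interpret A: left_module R A by fact
  interpret B: left_module R B by fact
  have zB: "a \<odot>\<^bsub>B\<^esub> \<zero>\<^bsub>B\<^esub> = \<zero>\<^bsub>B\<^esub>" if "a \<in> carrier R" for a
    using that B.smult_r_distr[of a "\<zero>\<^bsub>B\<^esub>" "\<zero>\<^bsub>B\<^esub>"] B.smult_closed[of a "\<zero>\<^bsub>B\<^esub>"]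
    by (metis B.M.add.r_cancel_one B.M.l_zero B.M.zero_closed)
  have "abelian_group (lmod_sum A B)"
  proof (rule abelian_groupI)
    fix x assume "x \<in> carrier (lmod_sum A B)"
    then show "\<exists>y\<in>carrier (lmod_sum A B). y \<oplus>\<^bsub>lmod_sum A B\<^esub> x = \<zero>\<^bsub>lmod_sum A B\<^esub>"
      by (intro bexI[of _ "(\<ominus>\<^bsub>A\<^esub> fst x, \<ominus>\<^bsub>B\<^esub> snd x)"])
        (auto simp: lmod_sum_def A.M.l_neg B.M.l_neg)
  qed (auto simp: lmod_sum_def A.M.a_ac B.M.a_ac)
  moreover have "left_module_axioms R (lmod_sum A B)"
    by unfold_locales
      (auto simp: lmod_sum_def A.smult_closed B.smult_closed A.smult_l_distr B.smult_l_distr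
        A.smult_r_distr B.smult_r_distr A.smult_assoc B.smult_assoc A.smult_one B.smult_one)
  ultimately have "left_module R (lmod_sum A B)"
    by (intro left_module.intro A.ring_axioms)
  then show ?thesis
    by (auto simp: is_extension_def split_extension_def lmod_hom_def lmod_sum_def inj_on_def
        a_kernel_def' zB image_iff)
qed

lemma Ext1_zero_in_Ext1:
  assumes "left_module R A" "left_module R B"
  shows "Ext1_zero R A B \<in> Ext1 R A B"
  unfolding Ext1_zero_def Ext1_def
  by (rule quotientI) (simp add: is_extension_split assms)

text \<open>Every extension, whatever the type of its middle term, is equivalent to one counted in
  \<^const>\<open>Ext1\<close>.\<close>

lemma ext_equivalent_product:
  fixes A :: "('d, 'a) module" and B :: "('d, 'b) module" and E :: "('d, 'a, 't, 'b) ses"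
  assumes "left_module R A" "left_module R B" and E: "is_extension R A B E"
  shows "\<exists>E' :: ('d, 'a, 'a \<times> 'b, 'b) ses. is_extension R A B E' \<and> ext_equivalent R A E E'"
proof -
  interpret A: left_module R A by fact
  interpret B: left_module R B by fact
  obtain T i p where ET: "E = (T, i, p)" by (cases E)
  have T: "left_module R T" and i: "i \<in> lmod_hom R A T" and p: "p \<in> lmod_hom R T B"
    and inj: "inj_on i (carrier A)" and ker: "i ` carrier A = {t\<in>carrier T. p t = \<zero>\<^bsub>B\<^esub>}"
    and surj: "p ` carrier T = carrier B"
    using E by (auto simp: ET is_extension_def a_kernel_def')
  interpret T: left_module R T by fact
  have i_cl: "i a \<in> carrier T" if "a \<in> carrier A" for a
    using i that by (auto simp: lmod_hom_def)
  have p_cl: "p t \<in> carrier B" if "t \<in> carrier T" for t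
    using p that by (auto simp: lmod_hom_def)
  have p_add: "p (s \<oplus>\<^bsub>T\<^esub> t) = p s \<oplus>\<^bsub>B\<^esub> p t" if "s \<in> carrier T" "t \<in> carrier T" for s t
    using p that by (auto simp: lmod_hom_def)
  have pi: "p (i a) = \<zero>\<^bsub>B\<^esub>" if "a \<in> carrier A" for a
    using ker that by auto
  define \<sigma> where "\<sigma> = inv_into (carrier T) p"
  have \<sigma>: "\<sigma> b \<in> carrier T" "p (\<sigma> b) = b" if "b \<in> carrier B" for b
    using that surj unfolding \<sigma>_def by (auto intro: inv_into_into f_inv_into_f)
  define \<theta> where "\<theta> = (\<lambda>(a, b). i a \<oplus>\<^bsub>T\<^esub> \<sigma> b)"
  have p\<theta>: "p (\<theta> (a, b)) = b" if "a \<in> carrier A" "b \<in> carrier B" for a b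
    using that by (simp add: \<theta>_def p_add i_cl \<sigma> pi)
  have \<theta>: "bij_betw \<theta> (carrier A \<times> carrier B) (carrier T)"
  proof (rule bij_betw_imageI)
    show "inj_on \<theta> (carrier A \<times> carrier B)"
    proof (rule inj_onI)
      fix x y assume x: "x \<in> carrier A \<times> carrier B" and y: "y \<in> carrier A \<times> carrier B"
        and eq: "\<theta> x = \<theta> y"
      obtain a b a' b' where [simp]: "x = (a, b)" "y = (a', b')" by (cases x, cases y)
      have "b = b'"
        using p\<theta>[of a b] p\<theta>[of a' b'] x y eq by simp
      with x y eq have "i a = i a'"
        by (simp add: \<theta>_def i_cl \<sigma>)
      with x y \<open>b = b'\<close> inj show "x = y"
        by (auto dest: inj_onD)
    qed
    show "\<theta> ` (carrier A \<times> carrier B) = carrier T"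
    proof
      show "\<theta> ` (carrier A \<times> carrier B) \<subseteq> carrier T"
        by (auto simp: \<theta>_def i_cl \<sigma>)
      show "carrier T \<subseteq> \<theta> ` (carrier A \<times> carrier B)"
      proof
        fix t assume t: "t \<in> carrier T"
        let ?s = "\<sigma> (p t)"
        have s: "?s \<in> carrier T" "p ?s = p t"
          using \<sigma> t p_cl by auto
        have "p (t \<ominus>\<^bsub>T\<^esub> ?s) \<oplus>\<^bsub>B\<^esub> p ?s = p t"
          using t s p_add[of "t \<ominus>\<^bsub>T\<^esub> ?s" ?s] by (simp add: T.M.minus_eq T.M.a_assoc T.M.l_neg)
        then have "p (t \<ominus>\<^bsub>T\<^esub> ?s) = \<zero>\<^bsub>B\<^esub>"
          using t s p_cl by (metis B.M.add.l_cancel_one' B.M.add.r_cancel_one' T.M.minus_closed)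
        then obtain a where a: "a \<in> carrier A" "t \<ominus>\<^bsub>T\<^esub> ?s = i a"
          using ker t s by (metis (mono_tags, lifting) T.M.minus_closed imageE mem_Collect_eq)
        have "t = \<theta> (a, p t)"
          using t s by (simp add: \<theta>_def a(2)[symmetric] T.M.minus_eq T.M.a_assoc T.M.l_neg)
        with a t p_cl show "t \<in> \<theta> ` (carrier A \<times> carrier B)"
          by blast
      qed
    qed
  qed
  define \<phi> where "\<phi> = inv_into (carrier A \<times> carrier B) \<theta>"
  have \<phi>: "bij_betw \<phi> (carrier T) (carrier A \<times> carrier B)"
    unfolding \<phi>_def using \<theta> by (rule bij_betw_inv_into)
  have \<phi>\<theta>: "\<phi> (\<theta> x) = x" "\<theta> x \<in> carrier T" if "x \<in> carrier A \<times> carrier B" for x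
    using that \<theta> by (auto simp only: \<phi>_def bij_betw_inv_into_left bij_betwE)
  have \<theta>\<phi>: "\<theta> (\<phi> t) = t" "\<phi> t \<in> carrier A \<times> carrier B" if "t \<in> carrier T" for t
    using that \<theta> \<phi> by (auto simp only: \<phi>_def bij_betw_inv_into_right bij_betwE)
  define T' :: "('d, 'a \<times> 'b) module" where
    "T' = \<lparr>carrier = carrier A \<times> carrier B, monoid.mult = undefined, one = undefined,
      zero = \<phi> \<zero>\<^bsub>T\<^esub>, add = (\<lambda>x y. \<phi> (\<theta> x \<oplus>\<^bsub>T\<^esub> \<theta> y)),
      module.smult = (\<lambda>a x. \<phi> (a \<odot>\<^bsub>T\<^esub> \<theta> x))\<rparr>"
  have T'_simps: "carrier T' = carrier A \<times> carrier B" "\<zero>\<^bsub>T'\<^esub> = \<phi> \<zero>\<^bsub>T\<^esub>"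
    "x \<oplus>\<^bsub>T'\<^esub> y = \<phi> (\<theta> x \<oplus>\<^bsub>T\<^esub> \<theta> y)" "a \<odot>\<^bsub>T'\<^esub> x = \<phi> (a \<odot>\<^bsub>T\<^esub> \<theta> x)" for a x y
    by (simp_all add: T'_def)
  note cl = \<theta>\<phi> \<phi>\<theta> T.smult_closed
  have "abelian_group T'"
  proof (rule abelian_groupI)
    fix x assume x: "x \<in> carrier T'"
    then show "\<exists>y\<in>carrier T'. y \<oplus>\<^bsub>T'\<^esub> x = \<zero>\<^bsub>T'\<^esub>"
      by (intro bexI[of _ "\<phi> (\<ominus>\<^bsub>T\<^esub> \<theta> x)"]) (simp_all only: T'_simps cl T.M.l_neg T.M.a_inv_closed)
  next
    fix x y assume "x \<in> carrier T'" "y \<in> carrier T'"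
    then show "x \<oplus>\<^bsub>T'\<^esub> y = y \<oplus>\<^bsub>T'\<^esub> x"
      by (simp only: T'_simps cl T.M.a_comm)
  qed (simp_all only: T'_simps cl T.M.a_closed T.M.zero_closed T.M.a_assoc T.M.l_zero)
  moreover have "left_module_axioms R T'"
    by unfold_locales (simp_all only: T'_simps cl T.M.a_closed T.smult_l_distr T.smult_r_distr
        T.smult_assoc T.smult_one A.R.a_closed A.R.m_closed A.R.one_closed)
  ultimately have T': "left_module R T'"
    by (intro left_module.intro A.ring_axioms)
  have \<phi>_hom: "\<phi> \<in> lmod_hom R T T'"
    unfolding lmod_hom_def by (intro CollectI conjI ballI funcsetI) (simp_all only: T'_simps cl)
  have \<theta>_hom: "\<theta> \<in> lmod_hom R T' T"
    unfolding lmod_hom_def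
    by (intro CollectI conjI ballI funcsetI) (simp_all only: T'_simps cl T.M.a_closed)
  let ?E' = "(T', \<phi> \<circ> i, p \<circ> \<theta>)"
  have "\<phi> \<circ> i \<in> lmod_hom R A T'"
    using i \<phi>_hom by (auto simp: lmod_hom_def Pi_iff)
  moreover have "p \<circ> \<theta> \<in> lmod_hom R T' B"
    using p \<theta>_hom by (auto simp: lmod_hom_def Pi_iff)
  moreover have "inj_on (\<phi> \<circ> i) (carrier A)"
    using inj \<phi> i_cl by (intro comp_inj_on) (auto simp: bij_betw_def intro: inj_on_subset)
  moreover have "(\<phi> \<circ> i) ` carrier A = a_kernel T' B (p \<circ> \<theta>)"
  proof -
    have "\<phi> ` {t\<in>carrier T. p t = \<zero>\<^bsub>B\<^esub>} = {x\<in>carrier T'. p (\<theta> x) = \<zero>\<^bsub>B\<^esub>}"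
    proof (intro equalityI subsetI)
      fix x assume "x \<in> \<phi> ` {t\<in>carrier T. p t = \<zero>\<^bsub>B\<^esub>}"
      then obtain t where "t \<in> carrier T" "p t = \<zero>\<^bsub>B\<^esub>" "x = \<phi> t"
        by blast
      then show "x \<in> {x\<in>carrier T'. p (\<theta> x) = \<zero>\<^bsub>B\<^esub>}"
        by (simp only: T'_simps mem_Collect_eq cl)
    next
      fix x assume "x \<in> {x\<in>carrier T'. p (\<theta> x) = \<zero>\<^bsub>B\<^esub>}"
      then show "x \<in> \<phi> ` {t\<in>carrier T. p t = \<zero>\<^bsub>B\<^esub>}"
        by (intro image_eqI[of _ _ "\<theta> x"]) (simp_all only: T'_simps mem_Collect_eq cl)
    qed
    then show ?thesis
      by (simp only: image_comp[symmetric] ker a_kernel_def' o_apply)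
  qed
  moreover have "(p \<circ> \<theta>) ` carrier T' = carrier B"
    using surj \<theta> by (simp only: image_comp[symmetric] T'_simps bij_betw_def)
  ultimately have "is_extension R A B ?E'"
    using T' by (simp add: is_extension_def)
  moreover have "ext_equivalent R A E ?E'"
    using \<phi>_hom \<phi> by (auto simp: ext_equivalent_def ET T'_simps cl intro!: bexI[of _ \<phi>])
  ultimately show ?thesis
    by blast
qed

end

theory Submission
  imports Defs
begin

text \<open>
  Let \<open>T\<close> be an extension with submodule \<open>L n\<close> and quotient \<open>L m\<close>.  On both ends \<open>x\<close>, \<open>u\<close> and
  \<open>g - 1\<close> act by zero, so on \<open>T\<close> they factor through maps \<open>L m \<rightarrow> L n\<close>, and any product of two of
  them vanishes.  The relations then say that \<open>u\<close>, \<open>g - 1\<close>, \<open>x\<close> behave like a weight basis (of weights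
  \<open>2, 0, -2\<close>) of the adjoint representation of \<open>sl\<^sub>2\<close> inside \<open>Hom (L m) (L n)\<close>.  By Clebsch-Gordan
  such a nonzero triple forces \<open>m - n \<in> {2, 0, -2}\<close>.

  Only one instance of Clebsch-Gordan is needed, and it has a direct proof (\<open>x_kills_lift_of_top\<close>).
  As \<open>x\<close> commutes with \<open>y\<close>, it is determined by the image \<open>w\<close> of the highest weight vector of
  \<open>L m\<close>.  This \<open>w\<close> has weight \<open>m - 2\<close> and is killed by \<open>y\<^bsup>m+1\<^esup>\<close>; but \<open>y\<^bsup>m+1\<^esup>\<close> is injective on that
  weight space of \<open>L n\<close> unless the weight occurs within \<open>m\<close> steps of the bottom of \<open>L n\<close>, which
  leaves the three values of \<open>m - n\<close>.  So for other values \<open>x\<close> kills \<open>T\<close>, and commuting with \<open>v\<close>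
  gives the same for \<open>g - 1\<close> and then for \<open>u\<close>.

  What remains on \<open>T\<close> is an action of \<open>sl\<^sub>2\<close>.  Its Casimir element is central there and acts by
  the scalar \<open>k (k + 2)\<close> on \<open>L k\<close>.  Since \<open>m \<noteq> n\<close>, the two scalars differ in characteristic zero,
  and an affine function of the Casimir element acts by \<open>1\<close> on the submodule and by \<open>0\<close> on the
  quotient.  It is a module endomorphism of \<open>T\<close> that retracts \<open>T\<close> onto the submodule, so the
  extension splits (\<open>split_if_central_projection\<close>).  Hence the class of the split extension is the
  only one.
\<close>

section \<open>A criterion for splitting\<close>

lemma (in abelian_group) add_minus_cancel:
  assumes "x \<in> carrier G" "y \<in> carrier G"
  shows "x \<oplus> (y \<ominus> x) = y"
  using assms a_lcomm[of x y "\<ominus> x"] by (simp add: minus_eq r_neg)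

lemma (in left_module) smult_zero_right:
  assumes "a \<in> carrier R"
  shows "a \<odot>\<^bsub>M\<^esub> \<zero>\<^bsub>M\<^esub> = \<zero>\<^bsub>M\<^esub>"
  using assms smult_r_distr[of a "\<zero>\<^bsub>M\<^esub>" "\<zero>\<^bsub>M\<^esub>"] smult_closed[of a "\<zero>\<^bsub>M\<^esub>"]
  by (metis M.add.r_cancel_one M.l_zero M.zero_closed)

lemma extension_eq_add_kernel:
  assumes "left_module R B" and E: "is_extension R A B (T, i, p)"
    and st: "s \<in> carrier T" "t \<in> carrier T" "p s = p t"
  shows "\<exists>a\<in>carrier A. s = t \<oplus>\<^bsub>T\<^esub> i a"
proof -
  have T: "left_module R T" and p: "p \<in> lmod_hom R T B"
    and ker: "i ` carrier A = {t\<in>carrier T. p t = \<zero>\<^bsub>B\<^esub>}"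
    using E by (auto simp: is_extension_def a_kernel_def')
  interpret B: left_module R B by fact
  interpret T: left_module R T by (rule T)
  have p_cl: "p x \<in> carrier B" if "x \<in> carrier T" for x
    using p that by (auto simp: lmod_hom_def)
  have d: "s \<ominus>\<^bsub>T\<^esub> t \<in> carrier T" and ds: "s = t \<oplus>\<^bsub>T\<^esub> (s \<ominus>\<^bsub>T\<^esub> t)"
    using st by (simp_all add: T.M.add_minus_cancel)
  have "p s = p t \<oplus>\<^bsub>B\<^esub> p (s \<ominus>\<^bsub>T\<^esub> t)"
    using p d st(2) by (subst ds) (simp add: lmod_hom_def)
  then have "p (s \<ominus>\<^bsub>T\<^esub> t) = \<zero>\<^bsub>B\<^esub>"
    using st d p_cl by (metis B.M.add.l_cancel_one' B.M.add.r_cancel_one' B.M.a_comm)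
  with d ds ker show ?thesis
    by (metis (mono_tags, lifting) imageE mem_Collect_eq)
qed

text \<open>The action of \<open>e\<close> on \<open>T\<close> is a module endomorphism with image in the submodule \<open>A\<close>, because it
  vanishes on the quotient, and it restricts to the identity of \<open>A\<close>.  So it is a retraction, and
  together with \<open>p\<close> it identifies \<open>T\<close> with \<open>A \<oplus> B\<close>.\<close>

lemma split_if_central_projection:
  assumes A: "left_module R A" and B: "left_module R B" and E: "is_extension R A B (T, i, p)"
    and e: "e \<in> carrier R"
    and eA: "\<And>a. a \<in> carrier A \<Longrightarrow> e \<odot>\<^bsub>A\<^esub> a = a"
    and eB: "\<And>b. b \<in> carrier B \<Longrightarrow> e \<odot>\<^bsub>B\<^esub> b = \<zero>\<^bsub>B\<^esub>"
    and eT: "\<And>r t. r \<in> carrier R \<Longrightarrow> t \<in> carrier T \<Longrightarrow>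
               e \<odot>\<^bsub>T\<^esub> (r \<odot>\<^bsub>T\<^esub> t) = r \<odot>\<^bsub>T\<^esub> (e \<odot>\<^bsub>T\<^esub> t)"
  shows "ext_equivalent R A (T, i, p) (split_extension A B)"
proof -
  have T: "left_module R T" and i: "i \<in> lmod_hom R A T" and p: "p \<in> lmod_hom R T B"
    and inj: "inj_on i (carrier A)" and ker: "i ` carrier A = {t\<in>carrier T. p t = \<zero>\<^bsub>B\<^esub>}"
    and surj: "p ` carrier T = carrier B"
    using E by (auto simp: is_extension_def a_kernel_def')
  interpret A: left_module R A by fact
  interpret B: left_module R B by fact
  interpret T: left_module R T by (rule T)
  have i_cl: "i a \<in> carrier T" if "a \<in> carrier A" for a
    using i that by (auto simp: lmod_hom_def)
  have i_add: "i (a \<oplus>\<^bsub>A\<^esub> b) = i a \<oplus>\<^bsub>T\<^esub> i b" if "a \<in> carrier A" "b \<in> carrier A" for a b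
    using i that by (auto simp: lmod_hom_def)
  have i_smult: "i (r \<odot>\<^bsub>A\<^esub> a) = r \<odot>\<^bsub>T\<^esub> i a" if "r \<in> carrier R" "a \<in> carrier A" for r a
    using i that by (auto simp: lmod_hom_def)
  have p_cl: "p t \<in> carrier B" if "t \<in> carrier T" for t
    using p that by (auto simp: lmod_hom_def)
  have p_add: "p (s \<oplus>\<^bsub>T\<^esub> t) = p s \<oplus>\<^bsub>B\<^esub> p t" if "s \<in> carrier T" "t \<in> carrier T" for s t
    using p that by (auto simp: lmod_hom_def)
  have p_smult: "p (r \<odot>\<^bsub>T\<^esub> t) = r \<odot>\<^bsub>B\<^esub> p t" if "r \<in> carrier R" "t \<in> carrier T" for r t
    using p that by (auto simp: lmod_hom_def)
  have pi: "p (i a) = \<zero>\<^bsub>B\<^esub>" if "a \<in> carrier A" for a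
    using ker that by auto
  have ei: "e \<odot>\<^bsub>T\<^esub> i a = i a" if "a \<in> carrier A" for a
    using i_smult[OF e that] eA[OF that] by simp
  have "e \<odot>\<^bsub>T\<^esub> t \<in> i ` carrier A" if "t \<in> carrier T" for t
    using that e by (simp add: ker T.smult_closed p_smult eB p_cl)
  then have "\<exists>a\<in>carrier A. i a = e \<odot>\<^bsub>T\<^esub> t" if "t \<in> carrier T" for t
    using that by fastforce
  then obtain \<rho> where \<rho>_cl: "\<And>t. t \<in> carrier T \<Longrightarrow> \<rho> t \<in> carrier A"
    and i\<rho>: "\<And>t. t \<in> carrier T \<Longrightarrow> i (\<rho> t) = e \<odot>\<^bsub>T\<^esub> t"
    by metis
  have \<rho>_eq: "\<rho> t = a" if "t \<in> carrier T" "a \<in> carrier A" "i a = e \<odot>\<^bsub>T\<^esub> t" for t a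
    using that \<rho>_cl i\<rho> inj by (metis inj_onD)
  have \<rho>i: "\<rho> (i a) = a" if "a \<in> carrier A" for a
    using that by (intro \<rho>_eq) (simp_all add: i_cl ei)
  have \<rho>_add: "\<rho> (s \<oplus>\<^bsub>T\<^esub> t) = \<rho> s \<oplus>\<^bsub>A\<^esub> \<rho> t" if "s \<in> carrier T" "t \<in> carrier T" for s t
    using that e by (intro \<rho>_eq) (simp_all add: i_add \<rho>_cl i\<rho> T.smult_r_distr)
  have \<rho>_smult: "\<rho> (r \<odot>\<^bsub>T\<^esub> t) = r \<odot>\<^bsub>A\<^esub> \<rho> t" if "r \<in> carrier R" "t \<in> carrier T" for r t
    using that e by (intro \<rho>_eq) (simp_all add: i_smult \<rho>_cl i\<rho> eT T.smult_closed A.smult_closed)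
  define \<phi> where "\<phi> = (\<lambda>t. (\<rho> t, p t))"
  have "\<phi> \<in> lmod_hom R T (lmod_sum A B)"
    by (auto simp: lmod_hom_def lmod_sum_def \<phi>_def \<rho>_cl p_cl \<rho>_add p_add \<rho>_smult p_smult)
  moreover have "bij_betw \<phi> (carrier T) (carrier A \<times> carrier B)"
  proof (rule bij_betw_imageI)
    show "inj_on \<phi> (carrier T)"
    proof (rule inj_onI)
      fix s t assume st: "s \<in> carrier T" "t \<in> carrier T" and eq: "\<phi> s = \<phi> t"
      then obtain a where a: "a \<in> carrier A" "s = t \<oplus>\<^bsub>T\<^esub> i a"
        using extension_eq_add_kernel[OF B E, of s t] by (auto simp: \<phi>_def)
      have "\<rho> t = \<rho> t \<oplus>\<^bsub>A\<^esub> a"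
        using eq a st by (simp add: \<phi>_def \<rho>_add i_cl \<rho>i)
      then have "a = \<zero>\<^bsub>A\<^esub>"
        using a st \<rho>_cl by (metis A.M.add.l_cancel_one')
      moreover have "i \<zero>\<^bsub>A\<^esub> = \<zero>\<^bsub>T\<^esub>"
        using i_add[of "\<zero>\<^bsub>A\<^esub>" "\<zero>\<^bsub>A\<^esub>"] i_cl[of "\<zero>\<^bsub>A\<^esub>"]
        by (metis A.M.l_zero A.M.zero_closed T.M.add.l_cancel_one)
      ultimately show "s = t"
        using a st by simp
    qed
    show "\<phi> ` carrier T = carrier A \<times> carrier B"
    proof
      show "\<phi> ` carrier T \<subseteq> carrier A \<times> carrier B"
        by (auto simp: \<phi>_def \<rho>_cl p_cl)
      show "carrier A \<times> carrier B \<subseteq> \<phi> ` carrier T"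
      proof clarify
        fix a b assume a: "a \<in> carrier A" and b: "b \<in> carrier B"
        obtain t where t: "t \<in> carrier T" "p t = b"
          using b by (metis surj imageE)
        define c where "c = a \<ominus>\<^bsub>A\<^esub> \<rho> t"
        have c: "c \<in> carrier A" "\<rho> t \<oplus>\<^bsub>A\<^esub> c = a"
          using a t \<rho>_cl by (simp_all add: c_def A.M.add_minus_cancel)
        have "\<phi> (t \<oplus>\<^bsub>T\<^esub> i c) = (a, b)"
          using c t b by (simp add: \<phi>_def \<rho>_add p_add i_cl \<rho>i pi)
        then show "(a, b) \<in> \<phi> ` carrier T"
          using c t i_cl by (metis T.M.a_closed image_eqI)
      qed
    qed
  qed
  ultimately show ?thesis
    by (auto simp: ext_equivalent_def split_extension_def lmod_sum_def \<phi>_def \<rho>i pi)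
qed


section \<open>Modules over the double of the Jordan plane, computed in the free algebra\<close>

text \<open>Elements of \<^const>\<open>D_ring\<close> are cosets.  Acting through representatives makes it possible to
  compute with the type-class arithmetic of the free algebra, modulo the annihilator of the module
  (a two-sided ideal that contains all relators).\<close>

definition D_act :: "(('k::field) free_alg set, 't) module \<Rightarrow> 'k free_alg \<Rightarrow> 't \<Rightarrow> 't" where
  "D_act T q t = (D_ideal +>\<^bsub>free_ring\<^esub> q) \<odot>\<^bsub>T\<^esub> t"

lemma ring_hom_coset:
  "ring_hom_ring free_ring D_ring (\<lambda>q :: ('k::field) free_alg. D_ideal +>\<^bsub>free_ring\<^esub> q)"
  unfolding D_ring_def by (rule ideal.rcos_ring_hom_ring[OF ideal_D_ideal])

lemma coset_in_D_ring: "D_ideal +>\<^bsub>free_ring\<^esub> (q :: ('k::field) free_alg) \<in> carrier D_ring"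
  using ring_hom_ring.homh[OF ring_hom_coset] by (auto simp: ring_hom_def free_ring_simps)

lemma D_ring_eq_coset:
  assumes "a \<in> carrier (D_ring :: ('k::field) free_alg set ring)"
  obtains q where "a = D_ideal +>\<^bsub>free_ring\<^esub> q"
  using assms by (auto simp: D_ring_def FactRing_def A_RCOSETS_def' free_ring_simps)

lemma D_act_L:
  fixes f :: "nat \<Rightarrow> 'k::field_char_0"
  assumes "f \<in> carrier (L n)"
  shows "D_act (L n) q f = free_act n q f"
  using assms by (simp add: D_act_def L_smult_coset)

lemma D_act_hom:
  assumes "h \<in> lmod_hom D_ring M N" "t \<in> carrier M"
  shows "h (D_act M q t) = D_act N q (h t)"
proof -
  have "\<forall>a\<in>carrier D_ring. h (a \<odot>\<^bsub>M\<^esub> t) = a \<odot>\<^bsub>N\<^esub> h t"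
    using assms by (simp add: lmod_hom_def)
  then show ?thesis
    unfolding D_act_def using coset_in_D_ring by (rule bspec)
qed

locale D_module = left_module D_ring T for T :: "(('k::field_char_0) free_alg set, 't) module"
begin

lemma D_act_closed: "t \<in> carrier T \<Longrightarrow> D_act T q t \<in> carrier T"
  by (simp add: D_act_def smult_closed coset_in_D_ring)

lemma D_act_plus:
  "t \<in> carrier T \<Longrightarrow> D_act T (q + r) t = D_act T q t \<oplus>\<^bsub>T\<^esub> D_act T r t"
  using ring_hom_add[OF ring_hom_ring.homh[OF ring_hom_coset], of q r]
  by (simp add: D_act_def smult_l_distr coset_in_D_ring free_ring_simps)

lemma D_act_mult:
  "t \<in> carrier T \<Longrightarrow> D_act T (q * r) t = D_act T q (D_act T r t)"
  using ring_hom_mult[OF ring_hom_ring.homh[OF ring_hom_coset], of q r]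
  by (simp add: D_act_def smult_assoc coset_in_D_ring free_ring_simps)

lemma D_act_add:
  "s \<in> carrier T \<Longrightarrow> t \<in> carrier T \<Longrightarrow> D_act T q (s \<oplus>\<^bsub>T\<^esub> t) = D_act T q s \<oplus>\<^bsub>T\<^esub> D_act T q t"
  by (simp add: D_act_def smult_r_distr coset_in_D_ring)

lemma D_act_at_zero [simp]: "D_act T q \<zero>\<^bsub>T\<^esub> = \<zero>\<^bsub>T\<^esub>"
  by (simp add: D_act_def smult_zero_right coset_in_D_ring)

lemma D_act_ideal:
  assumes "q \<in> D_ideal" "t \<in> carrier T"
  shows "D_act T q t = \<zero>\<^bsub>T\<^esub>"
proof -
  interpret ideal D_ideal "free_ring :: 'k free_alg ring" by (rule ideal_D_ideal)
  have "D_ideal +>\<^bsub>free_ring\<^esub> q = \<zero>\<^bsub>D_ring\<^esub>"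
    using assms(1) by (simp add: a_rcos_const D_ring_def FactRing_def)
  moreover have "\<zero>\<^bsub>D_ring\<^esub> \<odot>\<^bsub>T\<^esub> t = \<zero>\<^bsub>T\<^esub>"
    using assms(2) smult_l_distr[of "\<zero>\<^bsub>D_ring\<^esub>" "\<zero>\<^bsub>D_ring\<^esub>" t] smult_closed[of "\<zero>\<^bsub>D_ring\<^esub>" t]
    by (metis M.add.r_cancel_one R.l_zero R.zero_closed)
  ultimately show ?thesis
    by (simp add: D_act_def)
qed

definition ann :: "'k free_alg set" where
  "ann = {q. \<forall>t\<in>carrier T. D_act T q t = \<zero>\<^bsub>T\<^esub>}"

lemma annD: "q \<in> ann \<Longrightarrow> t \<in> carrier T \<Longrightarrow> D_act T q t = \<zero>\<^bsub>T\<^esub>"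
  by (simp add: ann_def)

lemma D_ideal_in_ann: "q \<in> D_ideal \<Longrightarrow> q \<in> ann"
  by (simp add: ann_def D_act_ideal)

lemma zero_in_ann [simp]: "0 \<in> ann"
  using additive_subgroup.zero_closed[OF ideal.axioms(1)[OF ideal_D_ideal]]
  by (intro D_ideal_in_ann) (simp add: free_ring_simps)

lemma ann_add: "q \<in> ann \<Longrightarrow> r \<in> ann \<Longrightarrow> q + r \<in> ann"
  by (simp add: ann_def D_act_plus)

lemma ann_mult_left: "q \<in> ann \<Longrightarrow> r * q \<in> ann"
  by (simp add: ann_def D_act_mult)

lemma ann_mult_right: "q \<in> ann \<Longrightarrow> q * r \<in> ann"
  by (simp add: ann_def D_act_mult D_act_closed)

lemma ann_minus: "q \<in> ann \<Longrightarrow> - q \<in> ann"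
  using ann_mult_left[of q "- 1"] by simp

lemma ann_diff: "q \<in> ann \<Longrightarrow> r \<in> ann \<Longrightarrow> q - r \<in> ann"
  using ann_add[OF _ ann_minus] by fastforce

lemma ann_sum: "(\<And>k. k \<in> S \<Longrightarrow> F k \<in> ann) \<Longrightarrow> sum F S \<in> ann"
  by (induction S rule: infinite_finite_induct) (simp_all add: ann_add)

lemmas ann_intros = ann_add ann_diff ann_minus ann_mult_left ann_mult_right

lemma D_act_cong:
  assumes "q - r \<in> ann" "t \<in> carrier T"
  shows "D_act T q t = D_act T r t"
  using D_act_plus[of t "q - r" r] assms by (simp add: annD D_act_closed)

lemma relator_in_ann: "q \<in> D_relators \<Longrightarrow> q \<in> ann"
  using ring.genideal_self[OF ring_free_ring, of D_relators]
  by (intro D_ideal_in_ann) (auto simp: D_ideal_def free_ring_simps)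

lemma relations_in_ann:
  shows "gvar GG * gvar GGinv - 1 \<in> ann"
    and "gvar GXi * gvar GY - (gvar GY * gvar GXi - 2 * gvar GY) \<in> ann"
    and "gvar GXi * gvar GX - (gvar GX * gvar GXi - 2 * gvar GX) \<in> ann"
    and "gvar GV * gvar GG - (gvar GG * gvar GV + gvar GG * gvar GU) \<in> ann"
    and "gvar GV * gvar GXi - (gvar GXi * gvar GV - 2 * gvar GV) \<in> ann"
    and "gvar GY * gvar GX - (gvar GX * gvar GY - scal (1/2) * (gvar GX * gvar GX)) \<in> ann"
    and "gvar GV * gvar GX - (gvar GX * gvar GV + (1 - gvar GG) + gvar GX * gvar GU) \<in> ann"
    and "gvar GV * gvar GY -
           (gvar GY * gvar GV + scal (1/2) * (gvar GG * gvar GXi) + gvar GY * gvar GU) \<in> ann"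
  by (rule relator_in_ann, simp add: D_relators_def Let_def)+

end


section \<open>The Casimir element\<close>

text \<open>With \<open>E = 2 v\<close>, \<open>F = y\<close>, \<open>H = \<xi>\<close> the relations \<open>[\<xi>, v] = 2 v\<close>, \<open>[\<xi>, y] = - 2 y\<close> and
  \<open>[v, y] = \<xi> / 2\<close> are those of \<open>sl\<^sub>2\<close>, and this is \<open>H\<^sup>2 + 2 H + 4 F E\<close>.\<close>

definition casimir :: "('k::field) free_alg" where
  "casimir = gvar GXi * gvar GXi + 2 * gvar GXi + 8 * (gvar GY * gvar GV)"

lemma scal_commute: "scal c * q = q * (scal c :: ('k::field) free_alg)"
proof -
  have "scal c * Poly_Mapping.single w d = Poly_Mapping.single w d * scal c" for w d
    by (simp add: mult_single plus_list_def mult.commute)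
  then show ?thesis
    by (subst (1 2) poly_mapping_sum_single[of q]) (simp add: sum_distrib_left sum_distrib_right)
qed

lemma free_alg_induct [case_names scal gvar add mult]:
  fixes q :: "('k::field) free_alg"
  assumes scal: "\<And>c. P (scal c)" and gvar: "\<And>a. P (gvar a)"
    and add: "\<And>q r. P q \<Longrightarrow> P r \<Longrightarrow> P (q + r)"
    and mult: "\<And>q r. P q \<Longrightarrow> P r \<Longrightarrow> P (q * r)"
  shows "P q"
proof -
  have word: "P (Poly_Mapping.single w c)" for w c
  proof (induction w)
    case (Cons a w)
    have "Poly_Mapping.single (a # w) c = gvar a * Poly_Mapping.single w c"
      by (simp add: mult_single plus_list_def)
    with Cons show ?case
      by (simp add: gvar mult)
  qed (rule scal)
  have "P (\<Sum>w\<in>S. Poly_Mapping.single w (Poly_Mapping.lookup q w))" for S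
    using scal[of 0] by (induction S rule: infinite_finite_induct) (simp_all add: add word)
  from this[of "Poly_Mapping.keys q"] show ?thesis
    by (simp only: poly_mapping_sum_single[symmetric])
qed

lemma (in D_module) ann_commute_all:
  assumes "\<And>a. e * gvar a - gvar a * e \<in> ann"
  shows "e * q - q * e \<in> ann"
proof (induction q rule: free_alg_induct)
  case (scal c)
  show ?case
    by (simp add: scal_commute)
next
  case (gvar a)
  show ?case by (rule assms)
next
  case (add q r)
  have "e * (q + r) - (q + r) * e = (e * q - q * e) + (e * r - r * e)"
    by (simp add: algebra_simps)
  with add show ?case
    by (simp only: ann_add)
next
  case (mult q r)
  have "e * (q * r) - (q * r) * e = (e * q - q * e) * r + q * (e * r - r * e)"
    by (simp add: algebra_simps)
  with mult show ?case
    by (simp only: ann_intros)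
qed

text \<open>The classical computation in \<open>sl\<^sub>2\<close>, with the defects \<open>r1\<close>, \<open>r2\<close>, \<open>r3\<close> of the three relations
  carried along: it expresses the commutators as elements of the two-sided ideal generated by the
  defects.\<close>

lemma casimir_commutators:
  fixes \<xi> y v r1 r2 r3 :: "'a :: ring_1"
  defines "C \<equiv> \<xi> * \<xi> + 2 * \<xi> + 8 * (y * v)"
  defines "r1 \<equiv> v * \<xi> - (\<xi> * v - 2 * v)"
    and "r2 \<equiv> \<xi> * y - (y * \<xi> - 2 * y)"
    and "r3 \<equiv> 2 * (v * y) - 2 * (y * v) - \<xi>"
  shows "C * \<xi> - \<xi> * C = 8 * (y * r1 - r2 * v)"
    and "C * v - v * C = - (\<xi> * r1) - r1 * \<xi> - 4 * (r3 * v)"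
    and "C * y - y * C = r2 * \<xi> + \<xi> * r2 + 4 * (y * r3)"
proof -
  have two: "2 * z = z + z" and four: "4 * z = (z + z) + (z + z)"
    and eight: "8 * z = ((z + z) + (z + z)) + ((z + z) + (z + z))" for z :: 'a
  proof -
    show two: "2 * z = z + z" for z :: 'a
      by (rule mult_2)
    have "4 * z = 2 * (2 * z)"
      by simp
    then show four: "4 * z = (z + z) + (z + z)"
      by (simp only: two)
    have "8 * z = 2 * (4 * z)"
      by simp
    then show "8 * z = ((z + z) + (z + z)) + ((z + z) + (z + z))"
      by (simp only: two four)
  qed
  show "C * \<xi> - \<xi> * C = 8 * (y * r1 - r2 * v)"
    and "C * v - v * C = - (\<xi> * r1) - r1 * \<xi> - 4 * (r3 * v)"
    and "C * y - y * C = r2 * \<xi> + \<xi> * r2 + 4 * (y * r3)"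
    unfolding C_def r1_def r2_def r3_def two four eight by (simp_all only: algebra_simps, simp_all)
qed

text \<open>Once \<open>x\<close>, \<open>u\<close> and \<open>g - 1\<close> annihilate the module, the three \<open>sl\<^sub>2\<close> relations hold on it and the
  remaining generators act by \<open>0\<close> or \<open>1\<close>.\<close>

lemma (in D_module) casimir_central:
  assumes x: "gvar GX \<in> ann" and u: "gvar GU \<in> ann" and g: "gvar GG - 1 \<in> ann"
  shows "casimir * q - q * casimir \<in> ann"
proof (rule ann_commute_all)
  fix a
  let ?u = "gvar GU :: 'k free_alg" and ?v = "gvar GV :: 'k free_alg"
    and ?\<xi> = "gvar GXi :: 'k free_alg" and ?g = "gvar GG :: 'k free_alg"
    and ?g' = "gvar GGinv :: 'k free_alg" and ?y = "gvar GY :: 'k free_alg"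
    and ?half = "scal (1/2) :: 'k free_alg"
  have half: "2 * (?half * z) = z" for z
  proof -
    have "2 * ?half = 1"
      by (simp add: mult_2 single_add[symmetric] flip: zero_list_def)
    then show ?thesis
      by (simp add: mult.assoc[symmetric])
  qed
  have g': "?g' - 1 \<in> ann"
  proof -
    have "(?g * ?g' - 1) - (?g - 1) * ?g' \<in> ann"
      by (intro ann_intros relations_in_ann g)
    then show ?thesis
      by (simp add: algebra_simps)
  qed
  have r1: "?v * ?\<xi> - (?\<xi> * ?v - 2 * ?v) \<in> ann" and r2: "?\<xi> * ?y - (?y * ?\<xi> - 2 * ?y) \<in> ann"
    by (rule relations_in_ann)+
  have r3: "2 * (?v * ?y) - 2 * (?y * ?v) - ?\<xi> \<in> ann"
  proof -
    have "2 * (?v * ?y - (?y * ?v + ?half * (?g * ?\<xi>) + ?y * ?u)) + 2 * (?y * ?u) + (?g - 1) * ?\<xi> \<in> ann"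
      by (intro ann_intros relations_in_ann g u)
    then show ?thesis
      by (simp add: algebra_simps half)
  qed
  have id: "e * z - z * e \<in> ann" if "z - 1 \<in> ann" for e z
  proof -
    have "e * (z - 1) - (z - 1) * e \<in> ann"
      by (intro ann_intros that)
    then show ?thesis
      by (simp add: algebra_simps)
  qed
  show "casimir * gvar a - gvar a * casimir \<in> ann"
  proof (cases a)
    case GU with u show ?thesis by (simp add: ann_intros)
  next
    case GX with x show ?thesis by (simp add: ann_intros)
  next
    case GG with g show ?thesis by (simp add: id)
  next
    case GGinv with g' show ?thesis by (simp add: id)
  next
    case GXi
    then show ?thesis
      unfolding casimir_def GXi casimir_commutators by (intro ann_intros r1 r2)
  next
    case GV
    then show ?thesis
      unfolding casimir_def GV casimir_commutators by (intro ann_intros r1 r3)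
  next
    case GY
    then show ?thesis
      unfolding casimir_def GY casimir_commutators by (intro ann_intros r2 r3)
  qed
qed

lemma free_act_numeral: "free_act n (numeral k) h = (\<lambda>j. numeral k * h j)"
  using free_act_single[of n "0 :: gen list" "numeral k" h] by simp (simp add: zero_list_def)

lemma casimir_L:
  fixes f :: "nat \<Rightarrow> 'k::field_char_0"
  assumes f: "\<forall>j>n. f j = 0"
  shows "free_act n casimir f = (\<lambda>j. of_nat n * (of_nat n + 2) * f j)"
proof
  have var: "free_act n (gvar a) h = gen_act n a h" for a and h :: "nat \<Rightarrow> 'k"
    by (simp add: free_act_single)
  have c: "\<forall>j>n. gen_act n a h j = 0" for a and h :: "nat \<Rightarrow> 'k"
    by (rule gen_act_closed)
  fix j
  show "free_act n casimir f j = of_nat n * (of_nat n + 2) * f j"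
    using f
    by (simp only: casimir_def free_act_plus free_act_mult var free_act_numeral gen_act_simps[OF c],
        simp only: gen_act_simps[OF f], cases j) (auto simp: field_simps)
qed


section \<open>Extensions of simple modules\<close>

locale D_extension =
  fixes n m :: nat and T :: "(('k::field_char_0) free_alg set, 't) module"
    and i :: "(nat \<Rightarrow> 'k) \<Rightarrow> 't" and p :: "'t \<Rightarrow> nat \<Rightarrow> 'k"
  assumes extension: "is_extension D_ring (L n) (L m) (T, i, p)"

sublocale D_extension \<subseteq> D_module T
  using extension by (auto simp: is_extension_def D_module_def)

context D_extension
begin

lemma i_hom: "i \<in> lmod_hom D_ring (L n) T" and p_hom: "p \<in> lmod_hom D_ring T (L m)"
  and i_inj: "inj_on i (carrier (L n))" and p_surj: "p ` carrier T = carrier (L m)"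
  and ker: "i ` carrier (L n) = {t\<in>carrier T. p t = (\<lambda>_. 0)}"
  using extension by (auto simp: is_extension_def a_kernel_def' L_def)

lemma i_closed: "w \<in> carrier (L n) \<Longrightarrow> i w \<in> carrier T"
  using i_hom by (auto simp: lmod_hom_def)

lemma p_closed: "t \<in> carrier T \<Longrightarrow> p t \<in> carrier (L m)"
  using p_hom by (auto simp: lmod_hom_def)

lemma D_act_i: "w \<in> carrier (L n) \<Longrightarrow> D_act T q (i w) = i (free_act n q w)"
  using D_act_hom[OF i_hom] by (simp add: D_act_L)

lemma p_D_act: "t \<in> carrier T \<Longrightarrow> p (D_act T q t) = free_act m q (p t)"
  using D_act_hom[OF p_hom] by (simp add: D_act_L p_closed)

lemma i_zero: "i (\<lambda>_. 0) = \<zero>\<^bsub>T\<^esub>"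
proof -
  have "(\<lambda>_. 0 :: 'k) \<in> carrier (L n)"
    by (simp add: L_def)
  moreover have "i ((\<lambda>_. 0) \<oplus>\<^bsub>L n\<^esub> (\<lambda>_. 0)) = i (\<lambda>_. 0) \<oplus>\<^bsub>T\<^esub> i (\<lambda>_. 0)"
    using i_hom calculation by (simp add: lmod_hom_def)
  ultimately show ?thesis
    using i_closed by (simp add: L_def)
qed

lemma i_eq_zero: "w \<in> carrier (L n) \<Longrightarrow> i w = \<zero>\<^bsub>T\<^esub> \<Longrightarrow> w = (\<lambda>_. 0)"
  using i_inj by (rule inj_onD) (simp_all add: i_zero L_def)

lemma kernel_killed:
  assumes q: "\<And>w. w \<in> carrier (L n) \<Longrightarrow> free_act n q w = (\<lambda>_. 0)"
    and t: "t \<in> carrier T" "p t = (\<lambda>_. 0)"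
  shows "D_act T q t = \<zero>\<^bsub>T\<^esub>"
proof -
  have "t \<in> i ` carrier (L n)"
    using t by (simp add: ker)
  then show ?thesis
    using q by (auto simp: D_act_i i_zero)
qed

lemma act_eq_if_same_image:
  assumes q: "\<And>w. w \<in> carrier (L n) \<Longrightarrow> free_act n q w = (\<lambda>_. 0)"
    and st: "s \<in> carrier T" "t \<in> carrier T" "p s = p t"
  shows "D_act T q s = D_act T q t"
proof -
  obtain a where a: "a \<in> carrier (L n)" "s = t \<oplus>\<^bsub>T\<^esub> i a"
    using extension_eq_add_kernel[OF left_module_L extension st] by blast
  with q st show ?thesis
    by (simp add: D_act_add D_act_closed i_closed D_act_i i_zero)
qed

text \<open>The factor \<open>r\<close> maps \<open>T\<close> into the submodule, which \<open>q\<close> kills.  This removes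
  the term \<open>x\<^sup>2\<close> from the relation between \<open>x\<close> and \<open>y\<close>.\<close>

lemma ann_mult_extension:
  assumes q: "\<And>w. w \<in> carrier (L n) \<Longrightarrow> free_act n q w = (\<lambda>_. 0)"
    and r: "\<And>w. w \<in> carrier (L m) \<Longrightarrow> free_act m r w = (\<lambda>_. 0)"
  shows "q * r \<in> ann"
proof -
  have "D_act T q (D_act T r t) = \<zero>\<^bsub>T\<^esub>" if t: "t \<in> carrier T" for t
    using q t r by (intro kernel_killed) (simp_all add: p_D_act p_closed D_act_closed)
  then show ?thesis
    by (simp add: ann_def D_act_mult)
qed

lemma free_act_x: "free_act k (gvar GX) h = (\<lambda>_. 0 :: 'k)"
  by (simp add: free_act_single gen_act_def)

lemma x_commutes_with_y: "gvar GX * gvar GY ^ k - gvar GY ^ k * gvar GX \<in> ann"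
proof (induction k)
  case (Suc k)
  let ?x = "gvar GX :: 'k free_alg" and ?y = "gvar GY :: 'k free_alg"
  have xx: "?x * ?x \<in> ann"
    by (rule ann_mult_extension) (simp_all add: free_act_x)
  have "(?y * ?x - (?x * ?y - scal (1/2) * (?x * ?x))) - scal (1/2) * (?x * ?x) \<in> ann"
    by (intro ann_intros relations_in_ann xx)
  then have yx: "?y * ?x - ?x * ?y \<in> ann"
    by (simp add: algebra_simps)
  have "?y * (?x * ?y ^ k - ?y ^ k * ?x) - (?y * ?x - ?x * ?y) * ?y ^ k \<in> ann"
    by (intro ann_intros Suc yx)
  then show ?case
    by (simp add: algebra_simps)
qed simp

lemma free_act_y_power:
  fixes f :: "nat \<Rightarrow> 'k"
  assumes "\<forall>j>l. f j = 0"
  shows "free_act l (gvar GY ^ k) f = (\<lambda>j. if k \<le> j \<and> j \<le> l then f (j - k) else 0)"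
proof (induction k)
  case (Suc k)
  have "free_act l (gvar GY ^ Suc k) f = gen_act l GY (free_act l (gvar GY ^ k) f)"
    by (simp add: free_act_mult free_act_single)
  with Suc assms show ?case
    by (auto simp: gen_act_simps fun_eq_iff)
qed (use assms in \<open>auto simp: fun_eq_iff not_le\<close>)

text \<open>The vector \<open>x b\<close> comes from some \<open>w\<close> in \<open>L n\<close>.  The relation between \<open>\<xi>\<close> and \<open>x\<close> gives it weight
  \<open>m - 2\<close>, so at most one coordinate \<open>j\<close> of \<open>w\<close> is nonzero, the one with \<open>n - 2 j = m - 2\<close>.  Since
  \<open>y\<^bsup>m+1\<^esup>\<close> kills the highest weight vector of \<open>L m\<close> and commutes with \<open>x\<close>, it kills \<open>w\<close>, which for
  a nonzero coordinate \<open>j\<close> means \<open>n < j + m + 1\<close>.  Together these leave only \<open>j \<le> 2\<close>, that is,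
  \<open>m - n = 2 - 2 j \<in> {2, 0, -2}\<close>.\<close>

lemma x_kills_lift_of_top:
  assumes nm: "int m - int n \<notin> {2, 0, -2}" and b: "b \<in> carrier T" "p b = zvec m 0"
  shows "D_act T (gvar GX) b = \<zero>\<^bsub>T\<^esub>"
proof -
  let ?x = "gvar GX :: 'k free_alg" and ?y = "gvar GY :: 'k free_alg" and ?\<xi> = "gvar GXi :: 'k free_alg"
  have "p (D_act T ?x b) = (\<lambda>_. 0)"
    by (simp add: p_D_act b free_act_x)
  then obtain w where w: "w \<in> carrier (L n)" and xb: "D_act T ?x b = i w"
    using b ker D_act_closed by blast
  have w0: "\<forall>j>n. w j = 0"
    using w by (simp add: L_def)
  have wt: "(of_nat n - 2 * of_nat j) * w j = (of_nat m - 2) * w j" for j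
  proof -
    let ?m = "scal (of_nat m) :: 'k free_alg"
    have "(?\<xi> - (?m - 2)) * ?x - ?x * (?\<xi> - ?m) \<in> ann"
      using relations_in_ann(3) by (simp add: algebra_simps scal_commute)
    then have "D_act T ((?\<xi> - (?m - 2)) * ?x) b = D_act T (?x * (?\<xi> - ?m)) b"
      using b(1) by (rule D_act_cong)
    moreover have "D_act T ?x (D_act T (?\<xi> - ?m) b) = \<zero>\<^bsub>T\<^esub>"
    proof (rule kernel_killed)
      show "p (D_act T (?\<xi> - ?m) b) = (\<lambda>_. 0)"
        by (auto simp: p_D_act b free_act_minus free_act_single gen_act_simps zvec_def)
    qed (simp_all add: free_act_x D_act_closed b)
    ultimately have "i (free_act n (?\<xi> - (?m - 2)) w) = \<zero>\<^bsub>T\<^esub>"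
      using w b by (simp add: D_act_mult xb D_act_i)
    then have "free_act n (?\<xi> - (?m - 2)) w = (\<lambda>_. 0)"
      using free_act_closed[OF w0] by (intro i_eq_zero) (simp_all add: L_def)
    moreover have "free_act n (?\<xi> - (?m - 2)) w j =
        (of_nat n - 2 * of_nat j) * w j - (of_nat m * w j - 2 * w j)"
      by (simp only: free_act_minus free_act_numeral) (simp add: free_act_single gen_act_simps[OF w0])
    ultimately show ?thesis
      by (simp add: left_diff_distrib)
  qed
  have "free_act n (?y ^ Suc m) w = (\<lambda>_. 0)"
  proof (rule i_eq_zero)
    have "D_act T (?y ^ Suc m * ?x) b = D_act T (?x * ?y ^ Suc m) b"
      by (rule D_act_cong[OF x_commutes_with_y b(1), symmetric])
    moreover have "D_act T ?x (D_act T (?y ^ Suc m) b) = \<zero>\<^bsub>T\<^esub>"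
    proof (rule kernel_killed)
      show "p (D_act T (?y ^ Suc m) b) = (\<lambda>_. 0)"
        using free_act_y_power[of m "zvec m 0" "Suc m"] by (auto simp: p_D_act b zvec_def)
    qed (simp_all add: free_act_x D_act_closed b)
    ultimately show "i (free_act n (?y ^ Suc m) w) = \<zero>\<^bsub>T\<^esub>"
      using w b by (simp only: D_act_mult xb D_act_i)
  qed (use free_act_closed[OF w0] in \<open>simp add: L_def\<close>)
  then have y0: "w j = 0" if "j + Suc m \<le> n" for j
    using that free_act_y_power[OF w0, of "Suc m"] by (auto simp: fun_eq_iff dest!: spec[of _ "j + Suc m"])
  have "w j = 0" for j
  proof (rule ccontr)
    assume j: "w j \<noteq> 0"
    then have "of_nat n - 2 * of_nat j = (of_nat m - 2 :: 'k)"
      using wt[of j] by simp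
    then have "(of_nat (n + 2) :: 'k) = of_nat (m + 2 * j)"
      by (simp add: algebra_simps)
    then have "n + 2 = m + 2 * j"
      by (simp only: of_nat_eq_iff)
    moreover have "j \<le> n" "n < j + Suc m"
      using j w0 y0[of j] by (auto simp: not_less[symmetric])
    ultimately have "j = 0 \<or> j = 1 \<or> j = 2" and "int m - int n = 2 - 2 * int j"
      by linarith+
    with nm show False
      by auto
  qed
  then show ?thesis
    using xb i_zero by (metis ext)
qed

text \<open>A lift \<open>b\<close> of the highest weight vector generates \<open>T\<close> modulo the submodule, already under
  polynomials in \<open>y\<close>; these commute with \<open>x\<close>, which kills both \<open>b\<close> and the submodule.\<close>

lemma x_in_ann:
  assumes nm: "int m - int n \<notin> {2, 0, -2}"
  shows "gvar GX \<in> ann"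
proof -
  let ?x = "gvar GX :: 'k free_alg" and ?y = "gvar GY :: 'k free_alg"
  obtain b where b: "b \<in> carrier T" "p b = zvec m 0"
    using p_surj zvec_in_carrier by (metis imageE)
  have "D_act T ?x t = \<zero>\<^bsub>T\<^esub>" if t: "t \<in> carrier T" for t
  proof -
    \<comment> \<open>Since \<open>y\<^sup>k\<close> sends \<open>z\<^sub>0\<close> to \<open>z\<^sub>k\<close>, this \<open>q\<close> sends \<open>z\<^sub>0\<close> to \<open>p t\<close>.\<close>
    define q where "q = (\<Sum>k\<le>m. scal (p t k) * ?y ^ k)"
    have pt: "\<forall>j>m. p t j = 0"
      using p_closed[OF t] by (simp add: L_def)
    have "free_act m q (zvec m 0) = p t"
    proof
      fix j
      have "free_act m q (zvec m 0) j =
          (\<Sum>k\<le>m. p t k * (if k \<le> j \<and> j \<le> m then zvec m 0 (j - k) else 0))"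
        using free_act_y_power[of m "zvec m 0"]
        by (simp add: q_def free_act_sum free_act_mult free_act_single zvec_def)
      also have "\<dots> = (\<Sum>k\<le>m. if k = j then p t k else 0)"
        by (rule sum.cong) (auto simp: zvec_def)
      also have "\<dots> = p t j"
        using pt by simp
      finally show "free_act m q (zvec m 0) j = p t j" .
    qed
    then have "D_act T ?x t = D_act T ?x (D_act T q b)"
      using t b by (intro act_eq_if_same_image) (simp_all add: free_act_x D_act_closed p_D_act)
    also have "\<dots> = D_act T (?x * q) b"
      by (simp add: D_act_mult b)
    also have "?x * q - q * ?x \<in> ann"
    proof -
      have "?x * q - q * ?x = (\<Sum>k\<le>m. scal (p t k) * (?x * ?y ^ k - ?y ^ k * ?x))"
      proof -
        have "?x * (scal s * z) = scal s * (?x * z)" for s z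
          by (metis mult.assoc scal_commute)
        then show ?thesis
          unfolding q_def sum_distrib_left sum_distrib_right sum_subtractf[symmetric]
          by (simp add: right_diff_distrib mult.assoc)
      qed
      then show ?thesis
        by (simp add: ann_sum ann_mult_left x_commutes_with_y)
    qed
    then have "D_act T (?x * q) b = D_act T (q * ?x) b"
      using b by (intro D_act_cong)
    also have "\<dots> = \<zero>\<^bsub>T\<^esub>"
      by (simp add: D_act_mult b x_kills_lift_of_top[OF nm b])
    finally show ?thesis .
  qed
  then show ?thesis
    by (simp add: ann_def)
qed

text \<open>With \<open>x\<close> gone, the relation for \<open>v x\<close> reduces to \<open>g = 1\<close>, and then the one for \<open>v g\<close> to \<open>u = 0\<close>,
  so the Casimir element is central on \<open>T\<close>.\<close>

lemma equivalent_to_split: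
  assumes nm: "int m - int n \<notin> {2, 0, -2}"
  shows "ext_equivalent D_ring (L n) (T, i, p) (split_extension (L n) (L m))"
proof -
  let ?x = "gvar GX :: 'k free_alg" and ?g = "gvar GG :: 'k free_alg"
    and ?u = "gvar GU :: 'k free_alg" and ?v = "gvar GV :: 'k free_alg"
  note x = x_in_ann[OF nm]
  have g: "?g - 1 \<in> ann"
  proof -
    have "(?v * ?x - (?x * ?v + (1 - ?g) + ?x * ?u)) - ?v * ?x + ?x * ?v + ?x * ?u \<in> ann"
      by (intro ann_intros relations_in_ann x)
    then show ?thesis
      by (simp add: algebra_simps)
  qed
  have u: "?u \<in> ann"
  proof -
    have "?v * (?g - 1) - (?g - 1) * ?v - (?g - 1) * ?u - (?v * ?g - (?g * ?v + ?g * ?u)) \<in> ann"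
      by (intro ann_intros relations_in_ann g)
    then show ?thesis
      by (simp add: algebra_simps)
  qed
  define c :: "nat \<Rightarrow> 'k" where "c k = of_nat k * (of_nat k + 2)" for k
  define d where "d = c m - c n"
  have "d \<noteq> 0"
  proof
    assume "d = 0"
    then have "(of_nat (m * (m + 2)) :: 'k) = of_nat (n * (n + 2))"
      by (simp add: d_def c_def algebra_simps)
    then have "m * (m + 2) = n * (n + 2)"
      by (simp only: of_nat_eq_iff)
    moreover have "k * (k + 2) < l * (l + 2)" if "k < l" for k l :: nat
      using that by (intro mult_strict_mono) auto
    ultimately have "m = n"
      by (metis nat_neq_iff)
    with nm show False
      by simp
  qed
  \<comment> \<open>The interpolation \<open>(c m - C) / (c m - c n)\<close>, equal to \<open>1\<close> at \<open>C = c n\<close> and to \<open>0\<close> at \<open>C = c m\<close>.\<close>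
  define e where "e = scal (inverse d) * (scal (c m) - casimir)"
  have e: "free_act k e f = (\<lambda>j. inverse d * (c m - c k) * f j)" if "f \<in> carrier (L k)" for k f
    using that
    by (simp add: e_def free_act_mult free_act_minus free_act_single casimir_L L_def c_def algebra_simps)
  have comm: "e * q - q * e \<in> ann" for q
  proof -
    have "e * q - q * e = scal (inverse d) * (q * casimir - casimir * q)"
    proof -
      have "q * scal s = scal s * q" and "q * (scal s * r) = scal s * (q * r)" for s r
        by (metis mult.assoc scal_commute)+
      then show ?thesis
        by (simp add: e_def algebra_simps)
    qed
    also have "\<dots> = - (scal (inverse d) * (casimir * q - q * casimir))"
      by (simp add: algebra_simps)
    also have "\<dots> \<in> ann"
      by (intro ann_intros casimir_central x g u)
    finally show ?thesis .
  qed
  show ?thesis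
  proof (rule split_if_central_projection[OF left_module_L left_module_L extension coset_in_D_ring[of e]])
    fix a :: "nat \<Rightarrow> 'k" assume "a \<in> carrier (L n)"
    then show "(D_ideal +>\<^bsub>free_ring\<^esub> e) \<odot>\<^bsub>L n\<^esub> a = a"
      using \<open>d \<noteq> 0\<close> by (simp add: L_smult_coset e flip: d_def)
  next
    fix b :: "nat \<Rightarrow> 'k" assume "b \<in> carrier (L m)"
    then show "(D_ideal +>\<^bsub>free_ring\<^esub> e) \<odot>\<^bsub>L m\<^esub> b = \<zero>\<^bsub>L m\<^esub>"
      by (simp add: L_smult_coset e) (simp add: L_def)
  next
    fix r and t assume r: "r \<in> carrier (D_ring :: 'k free_alg set ring)" and t: "t \<in> carrier T"
    obtain q where q: "r = D_ideal +>\<^bsub>free_ring\<^esub> q"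
      using r by (rule D_ring_eq_coset)
    have "D_act T e (D_act T q t) = D_act T q (D_act T e t)"
      using D_act_cong[OF comm[of q] t] t by (simp add: D_act_mult)
    then show "(D_ideal +>\<^bsub>free_ring\<^esub> e) \<odot>\<^bsub>T\<^esub> (r \<odot>\<^bsub>T\<^esub> t) =
        r \<odot>\<^bsub>T\<^esub> ((D_ideal +>\<^bsub>free_ring\<^esub> e) \<odot>\<^bsub>T\<^esub> t)"
      by (simp add: D_act_def q)
  qed
qed

end

theorem lemma6p2:
  fixes n m :: nat
  assumes "Ext1 (D_ring :: ('k :: {alg_closed_field, field_char_0}) free_alg set ring) (L n) (L m)
             \<noteq> {Ext1_zero D_ring (L n) (L m)}"
  shows "int m - int n \<in> {2, 0, -2}"
proof (rule ccontr)
  let ?R = "D_ring :: 'k free_alg set ring"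
  assume nm: "int m - int n \<notin> {2, 0, -2}"
  have "ext_rel ?R (L n) (L m) `` {E} = Ext1_zero ?R (L n) (L m)"
    if E: "is_extension ?R (L n) (L m) E" for E
  proof -
    obtain T i p where [simp]: "E = (T, i, p)" by (cases E)
    interpret D_extension n m T i p
      using E by unfold_locales simp
    have "(E, split_extension (L n) (L m)) \<in> ext_rel ?R (L n) (L m)"
      using E equivalent_to_split[OF nm] by (simp add: ext_rel_def is_extension_split left_module_L)
    then show ?thesis
      unfolding Ext1_zero_def by (rule equiv_class_eq[OF equiv_ext_rel])
  qed
  then have "Ext1 ?R (L n) (L m) \<subseteq> {Ext1_zero ?R (L n) (L m)}"
    by (auto simp: Ext1_def quotient_def)
  moreover have "Ext1_zero ?R (L n) (L m) \<in> Ext1 ?R (L n) (L m)"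
    by (intro Ext1_zero_in_Ext1 left_module_L)
  ultimately show False
    using assms by blast
qed

end
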